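(* Let $G$ be a graph on $n$ vertices. Let $\mathcal{A}$ and $\mathcal{B}$ be sets of subgraphs of $G$ such that every element of $\mathcal{A}$ is a complete graph $K_{m}$ for some $m \geq 2$ (depending on the element), and every element of $\mathcal{B}$ is a complete bipartite graph $K_{1,m}$ for some $m \geq 2$ (depending on the element). Suppose that $\mathcal{A} \cup \mathcal{B}$ is an edge cover of $G$. Then $$\operatorname{reg}(R/J_{G}) \leq \#\mathcal{A} + 2\cdot \#\mathcal{B}.$$
   Context: Graphs are finite and simple (no loops, no multiple edges). $V(G)$ and $E(G)$ denote the vertex and edge sets of $G$. Let $\Bbbk$ be any field. For a graph $G$ on $n$ vertices, labelled $1,\dots,n$, let $R = \Bbbk[x_1,\dots,x_n,y_1,\dots,y_n]$ with the standard grading. The binomial edge ideal of $G$ is $J_G = (x_i y_j - x_j y_i \mid \{i,j\} \in E(G)) \subseteq R$. $\operatorname{reg}$ denotes the Castelnuovo--Mumford regularity of a finitely generated graded $R$-module. $K_m$ is the complete graph on $m$ vertices. $K_{1,m}$ is the star with vertex set $\{1,\dots,m+1\}$ and edge set $\{\{1,i\} \mid 2 \le i \le m+1\}$ (up to isomorphism). Subgraphs need not be induced. A set $\mathcal{C}$ of subgraphs of $G$ is an edge cover of $G$ if $E(G) = \bigcup_{H \in \mathcal{C}} E(H)$. $\#$ denotes cardinality. *)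

theory Defs
  imports
    Main
    "HOL-Library.Poly_Mapping"
    "HOL-Library.Extended_Real"
    "Jordan_Normal_Form.Matrix"
begin

section \<open>Graphs\<close>

type_synonym 'v graph = "'v set \<times> 'v set set"

abbreviation verts :: "'v graph \<Rightarrow> 'v set" where "verts \<equiv> fst"

abbreviation edges :: "'v graph \<Rightarrow> 'v set set" where "edges \<equiv> snd"

definition simple_graph :: "'v graph \<Rightarrow> bool" where
  "simple_graph G \<longleftrightarrow> finite (verts G) \<and> (\<forall>e\<in>edges G. e \<subseteq> verts G \<and> card e = 2)"

definition subgraph_of :: "'v graph \<Rightarrow> 'v graph \<Rightarrow> bool" where
  "subgraph_of H G \<longleftrightarrow> simple_graph H \<and> verts H \<subseteq> verts G \<and> edges H \<subseteq> edges G"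

definition graph_isomorphic :: "'v graph \<Rightarrow> 'w graph \<Rightarrow> bool" where
  "graph_isomorphic G H \<longleftrightarrow>
     (\<exists>f. bij_betw f (verts G) (verts H) \<and> (\<lambda>e. f ` e) ` edges G = edges H)"

definition complete_graph :: "nat \<Rightarrow> nat graph" where
  "complete_graph m = ({1..m}, {{i, j} | i j. i \<in> {1..m} \<and> j \<in> {1..m} \<and> i \<noteq> j})"

definition star_graph :: "nat \<Rightarrow> nat graph" where
  "star_graph m = ({1..m + 1}, {{1, i} | i. i \<in> {2..m + 1}})"

definition edge_cover :: "'v graph set \<Rightarrow> 'v graph \<Rightarrow> bool" where
  "edge_cover \<C> G \<longleftrightarrow> (\<forall>H\<in>\<C>. subgraph_of H G) \<and> edges G = (\<Union>H\<in>\<C>. edges H)"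


section \<open>Standard graded polynomial rings\<close>

text \<open>Polynomials with coefficients in \<open>'k\<close> whose indeterminates are the elements of \<open>'x\<close>;
  a monomial is its exponent vector. For finite \<open>'x\<close> and a field \<open>'k\<close> this type is the whole
  polynomial ring, so ideals and free modules need no carrier sets.\<close>

type_synonym ('x, 'k) mpoly = "('x \<Rightarrow>\<^sub>0 nat) \<Rightarrow>\<^sub>0 'k"

definition indet :: "'x \<Rightarrow> ('x, 'k::comm_ring_1) mpoly" where
  "indet x = Poly_Mapping.single (Poly_Mapping.single x 1) 1"

definition ideal_gen :: "'a::comm_ring_1 set \<Rightarrow> 'a set" where
  "ideal_gen B = module.span (*) B"

definition monom_degree :: "('x::finite \<Rightarrow>\<^sub>0 nat) \<Rightarrow> nat" where
  "monom_degree t = (\<Sum>x\<in>UNIV. Poly_Mapping.lookup t x)"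

text \<open>The graded component of degree \<open>j\<close>; it is \<open>{0}\<close> for negative \<open>j\<close>.\<close>

definition homogeneous :: "int \<Rightarrow> ('x::finite, 'k::field) mpoly set" where
  "homogeneous j = {p. \<forall>t\<in>Poly_Mapping.keys p. int (monom_degree t) = j}"

definition irrelevant_ideal :: "('x::finite, 'k::field) mpoly set" where
  "irrelevant_ideal = ideal_gen (range indet)"


section \<open>Castelnuovo--Mumford regularity\<close>

text \<open>
  Let \<open>R\<close> be the polynomial ring \<open>('x, 'k) mpoly\<close>. A graded \<open>R\<close>-module is presented here as
  \<open>M = 'm / N\<close>, where the type \<open>'m\<close> is an \<open>R\<close>-module with scalar multiplication \<open>scale\<close> and graded
  components \<open>gr j\<close>, and \<open>N\<close> is a graded submodule. This covers a quotient ring \<open>R/I\<close> without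
  a type for it (\<open>'m = R\<close>, \<open>N = I\<close>), and \<open>'m\<close> itself (\<open>N = {0}\<close>).

  A graded free resolution of \<open>M\<close> by finitely generated modules
  \<open>\<dots> \<rightarrow> F\<^sub>2 \<rightarrow> F\<^sub>1 \<rightarrow> F\<^sub>0 \<rightarrow> M \<rightarrow> 0\<close> consists of the following data:
  \<^item> \<open>F\<^sub>i\<close> is free with basis \<open>e\<^sub>k\<close>, \<open>k < b i\<close>, where \<open>e\<^sub>k\<close> has degree \<open>d i k\<close>,
    i.e. \<open>F\<^sub>i = \<Oplus>\<^sub>k R(- d i k)\<close>; its elements are the vectors in \<open>carrier_vec (b i)\<close>;
  \<^item> \<open>\<phi> i\<close> is the matrix of the differential from \<open>F\<close> in homological degree \<open>i + 1\<close> to \<open>F\<^sub>i\<close>;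
  \<^item> \<open>g k \<in> 'm\<close> is a homogeneous representative of the image of \<open>e\<^sub>k \<in> F\<^sub>0\<close> in \<open>M\<close>.
\<close>

definition augmentation ::
  "('r \<Rightarrow> 'm \<Rightarrow> 'm::ab_group_add) \<Rightarrow> nat \<Rightarrow> (nat \<Rightarrow> 'm) \<Rightarrow> 'r vec \<Rightarrow> 'm" where
  "augmentation scale n g v = (\<Sum>k<n. scale (v $ k) (g k))"

definition graded_free_resolution ::
  "(('x::finite, 'k::field) mpoly \<Rightarrow> 'm \<Rightarrow> 'm::ab_group_add) \<Rightarrow> (int \<Rightarrow> 'm set) \<Rightarrow> 'm set \<Rightarrow>
   (nat \<Rightarrow> nat) \<Rightarrow> (nat \<Rightarrow> nat \<Rightarrow> int) \<Rightarrow> (nat \<Rightarrow> ('x, 'k) mpoly mat) \<Rightarrow> (nat \<Rightarrow> 'm) \<Rightarrow> bool" where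
  "graded_free_resolution scale gr N b d \<phi> g \<longleftrightarrow>
     \<comment> \<open>the maps are homogeneous of degree \<open>0\<close>\<close>
     (\<forall>i. \<phi> i \<in> carrier_mat (b i) (b (Suc i))) \<and>
     (\<forall>i. \<forall>l<b i. \<forall>k<b (Suc i). \<phi> i $$ (l, k) \<in> homogeneous (d (Suc i) k - d i l)) \<and>
     (\<forall>k<b 0. g k \<in> gr (d 0 k)) \<and>
     \<comment> \<open>exactness at \<open>M\<close>, at \<open>F\<^sub>0\<close>, and in positive homological degrees\<close>
     (\<forall>m. \<exists>v\<in>carrier_vec (b 0). m - augmentation scale (b 0) g v \<in> N) \<and>
     {\<phi> 0 *\<^sub>v w | w. w \<in> carrier_vec (b 1)} =
       {v \<in> carrier_vec (b 0). augmentation scale (b 0) g v \<in> N} \<and>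
     (\<forall>i. {\<phi> (Suc i) *\<^sub>v w | w. w \<in> carrier_vec (b (Suc (Suc i)))} =
       {v \<in> carrier_vec (b (Suc i)). \<phi> i *\<^sub>v v = 0\<^sub>v (b i)})"

definition minimal_graded_free_resolution ::
  "(('x::finite, 'k::field) mpoly \<Rightarrow> 'm \<Rightarrow> 'm::ab_group_add) \<Rightarrow> (int \<Rightarrow> 'm set) \<Rightarrow> 'm set \<Rightarrow>
   (nat \<Rightarrow> nat) \<Rightarrow> (nat \<Rightarrow> nat \<Rightarrow> int) \<Rightarrow> (nat \<Rightarrow> ('x, 'k) mpoly mat) \<Rightarrow> (nat \<Rightarrow> 'm) \<Rightarrow> bool" where
  "minimal_graded_free_resolution scale gr N b d \<phi> g \<longleftrightarrow>
     graded_free_resolution scale gr N b d \<phi> g \<and>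
     (\<forall>i. \<forall>l<b i. \<forall>k<b (Suc i). \<phi> i $$ (l, k) \<in> irrelevant_ideal)"

text \<open>
  The regularity is the maximum of \<open>d i k - i\<close> over all basis elements of the minimal graded free
  resolution, i.e. the maximum of \<open>j - i\<close> over all nonzero graded Betti numbers
  \<open>\<beta>\<^sub>i\<^sub>,\<^sub>j(M)\<close>. A finitely generated graded module has a minimal graded free
  resolution, and any two are isomorphic, so ranging over all of them below does not change the
  set of values. The supremum is taken in the extended reals so that the zero module has
  regularity \<open>-\<infinity>\<close>.
\<close>

definition cm_regularity ::
  "(('x::finite, 'k::field) mpoly \<Rightarrow> 'm \<Rightarrow> 'm::ab_group_add) \<Rightarrow> (int \<Rightarrow> 'm set) \<Rightarrow> 'm set \<Rightarrow> ereal"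
  where
  "cm_regularity scale gr N =
     Sup {ereal (real_of_int (d i k) - real i) | b d \<phi> g i k.
            minimal_graded_free_resolution scale gr N b d \<phi> g \<and> k < b i}"

definition reg_quotient_ring :: "('x::finite, 'k::field) mpoly set \<Rightarrow> ereal" where
  "reg_quotient_ring I = cm_regularity (*) homogeneous I"


section \<open>Binomial edge ideals\<close>

text \<open>The indeterminates are indexed by \<open>'v + 'v\<close>: \<open>Inl i\<close> stands for \<open>x\<^sub>i\<close> and
  \<open>Inr i\<close> for \<open>y\<^sub>i\<close>.\<close>

definition binomial_edge_ideal :: "'v::finite graph \<Rightarrow> ('v + 'v, 'k::field) mpoly set" where
  "binomial_edge_ideal G =
     ideal_gen {indet (Inl i) * indet (Inr j) - indet (Inl j) * indet (Inr i) | i j.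
                  {i, j} \<in> edges G}"

end

theory Submission
  imports Defs "HOL-Library.Countable"
begin

text \<open>
  Regularity is read off Koszul homology: if the Koszul homology of \<open>R/I\<close> vanishes in internal
  degrees above \<open>i + r\<close>, a chase through the double complex of the Koszul complex and a minimal
  resolution shows that no basis vector of the resolution exceeds degree \<open>i + r\<close>. For binomial edge
  ideals, completing the neighbourhood of a vertex \<open>v\<close> to a clique gives a graph \<open>G\<^sub>v\<close> with
  \<open>J\<^sub>G = J\<^bsub>G\<^sub>v\<^esub> \<inter> (J\<^bsub>G - v\<^esub> + (x\<^sub>v, y\<^sub>v))\<close> (Ohtani), and the sum of the two ideals belongs to
  \<open>G\<^sub>v - v\<close>. If \<open>v\<close> is the centre of a star or lies in two cliques of the cover, then \<open>G\<^sub>v\<close> has a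
  strictly cheaper cover, so the long exact sequence gives the bound by induction. Otherwise the graph
  is a disjoint union of cliques; there \<open>x\<^sub>n\<close> is a nonzerodivisor for every vertex \<open>n\<close> of a clique
  \<open>C\<close>, and modulo \<open>x\<^sub>n\<close> the ideal is the intersection of the ideal in which \<open>n\<close> is deleted and the
  one in which \<open>C\<close> is replaced by the variables \<open>x\<^sub>i\<close>, \<open>i \<in> C\<close>.
\<close>

abbreviation (input) "single \<equiv> Poly_Mapping.single"
abbreviation (input) "lookup \<equiv> Poly_Mapping.lookup"
abbreviation (input) "keys \<equiv> Poly_Mapping.keys"

section \<open>Ideals and monomials\<close>

lemma module_mult: "Modules.module ((*) :: 'a::comm_ring_1 \<Rightarrow> 'a \<Rightarrow> 'a)"
  by standard (simp_all add: algebra_simps)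

lemma ideal_gen_base: "b \<in> B \<Longrightarrow> b \<in> ideal_gen B"
  unfolding ideal_gen_def by (rule Modules.module.span_base[OF module_mult])

lemma ideal_gen_zero [simp]: "0 \<in> ideal_gen B"
  unfolding ideal_gen_def by (rule Modules.module.span_zero[OF module_mult])

lemma ideal_gen_add: "p \<in> ideal_gen B \<Longrightarrow> q \<in> ideal_gen B \<Longrightarrow> p + q \<in> ideal_gen B"
  unfolding ideal_gen_def by (rule Modules.module.span_add[OF module_mult])

lemma ideal_gen_diff: "p \<in> ideal_gen B \<Longrightarrow> q \<in> ideal_gen B \<Longrightarrow> p - q \<in> ideal_gen B"
  unfolding ideal_gen_def by (rule Modules.module.span_diff[OF module_mult])

lemma ideal_gen_uminus: "p \<in> ideal_gen B \<Longrightarrow> - p \<in> ideal_gen B"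
  unfolding ideal_gen_def by (rule Modules.module.span_neg[OF module_mult])

lemma ideal_gen_mult: "p \<in> ideal_gen B \<Longrightarrow> r * p \<in> ideal_gen B"
  unfolding ideal_gen_def by (rule Modules.module.span_scale[OF module_mult])

lemma ideal_gen_mult_right: "p \<in> ideal_gen B \<Longrightarrow> p * r \<in> ideal_gen B"
  using ideal_gen_mult[of p B r] by (simp add: mult.commute)

lemma ideal_gen_sum: "(\<And>x. x \<in> A \<Longrightarrow> f x \<in> ideal_gen B) \<Longrightarrow> sum f A \<in> ideal_gen B"
  unfolding ideal_gen_def by (rule Modules.module.span_sum[OF module_mult])

lemma ideal_gen_induct [consumes 1, case_names zero step]:
  assumes "p \<in> ideal_gen B"
    and "P 0" and "\<And>r b q. b \<in> B \<Longrightarrow> q \<in> ideal_gen B \<Longrightarrow> P q \<Longrightarrow> P (r * b + q)"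
  shows "P p"
proof -
  have "p \<in> ideal_gen B \<and> P p"
    using assms(1) unfolding ideal_gen_def
    apply (rule Modules.module.span_induct_alt[OF module_mult])
    using assms(2,3) unfolding ideal_gen_def[symmetric]
    by (auto intro: ideal_gen_add ideal_gen_mult ideal_gen_base)
  then show ?thesis ..
qed

lemma ideal_gen_subsetI:
  assumes "\<And>b. b \<in> B \<Longrightarrow> b \<in> ideal_gen C"
  shows "ideal_gen B \<subseteq> ideal_gen C"
proof
  fix p assume "p \<in> ideal_gen B"
  then show "p \<in> ideal_gen C"
    by (induction rule: ideal_gen_induct) (auto intro: ideal_gen_add ideal_gen_mult assms)
qed

lemma ideal_gen_mono: "B \<subseteq> C \<Longrightarrow> ideal_gen B \<subseteq> ideal_gen C"
  by (rule ideal_gen_subsetI) (auto intro: ideal_gen_base)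

lemma ideal_gen_UnE:
  assumes "p \<in> ideal_gen (B \<union> C)"
  obtains q r where "q \<in> ideal_gen B" "r \<in> ideal_gen C" "p = q + r"
  using assms unfolding ideal_gen_def Modules.module.span_Un[OF module_mult] by blast

lemma ideal_gen_insertE:
  assumes "p \<in> ideal_gen (insert b B)"
  obtains r q where "q \<in> ideal_gen B" "p = q + b * r"
proof -
  obtain k where "p - k * b \<in> ideal_gen B"
    using assms unfolding ideal_gen_def Modules.module.span_insert[OF module_mult] by blast
  then show thesis using that[of "p - k * b" k] by (simp add: algebra_simps)
qed

section \<open>Restriction of a polynomial to a set of monomials\<close>

lift_definition restrict_keys :: "('a \<Rightarrow> bool) \<Rightarrow> ('a \<Rightarrow>\<^sub>0 'b::zero) \<Rightarrow> 'a \<Rightarrow>\<^sub>0 'b"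
  is "\<lambda>P f t. if P t then f t else 0"
  by (rule finite_subset[rotated]) auto

lemma lookup_restrict_keys: "lookup (restrict_keys P p) t = (if P t then lookup p t else 0)"
  by transfer simp

lemma keys_restrict_keys: "keys (restrict_keys P p) = {t \<in> keys p. P t}"
  by (auto simp: in_keys_iff lookup_restrict_keys split: if_splits)

lemma restrict_keys_zero [simp]: "restrict_keys P 0 = 0"
  by (rule poly_mapping_eqI) (simp add: lookup_restrict_keys)

lemma restrict_keys_add: "restrict_keys P (p + q) = restrict_keys P p + restrict_keys P q"
  by (rule poly_mapping_eqI) (simp add: lookup_restrict_keys lookup_add)

lemma restrict_keys_diff:
  "restrict_keys P (p - q) = restrict_keys P p - restrict_keys P (q :: _ \<Rightarrow>\<^sub>0 'b::ab_group_add)"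
  by (rule poly_mapping_eqI) (simp add: lookup_restrict_keys lookup_minus)

lemma restrict_keys_uminus:
  "restrict_keys P (- q) = - restrict_keys P (q :: _ \<Rightarrow>\<^sub>0 'b::ab_group_add)"
  by (rule poly_mapping_eqI) (simp add: lookup_restrict_keys)

lemma restrict_keys_sum: "restrict_keys P (sum f A) = (\<Sum>x\<in>A. restrict_keys P (f x))"
  by (induction A rule: infinite_finite_induct) (auto simp: restrict_keys_add)

lemma restrict_keys_single: "restrict_keys P (single t a) = (if P t then single t a else 0)"
  by (rule poly_mapping_eqI) (auto simp: lookup_restrict_keys lookup_single when_def)

lemma restrict_keys_id: "(\<And>t. t \<in> keys p \<Longrightarrow> P t) \<Longrightarrow> restrict_keys P p = p"
  by (rule poly_mapping_eqI) (auto simp: lookup_restrict_keys in_keys_iff)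

lemma restrict_keys_eq_0: "(\<And>t. t \<in> keys p \<Longrightarrow> \<not> P t) \<Longrightarrow> restrict_keys P p = 0"
  by (rule poly_mapping_eqI) (auto simp: lookup_restrict_keys in_keys_iff)

lemma poly_mapping_eq_sum_single: "p = (\<Sum>t\<in>keys p. single t (lookup p t))"
proof (rule poly_mapping_eqI)
  fix u
  have "lookup (\<Sum>t\<in>keys p. single t (lookup p t)) u = (\<Sum>t\<in>keys p. if t = u then lookup p t else 0)"
    by (simp add: lookup_sum lookup_single when_def)
  then show "lookup p u = lookup (\<Sum>t\<in>keys p. single t (lookup p t)) u"
    by (auto simp: in_keys_iff)
qed

lemma poly_mapping_single_induct [case_names zero single]:
  fixes p :: "'a \<Rightarrow>\<^sub>0 'b::comm_monoid_add"
  assumes "P 0" and "\<And>t a q. P q \<Longrightarrow> P (single t a + q)"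
  shows "P p"
proof -
  have "P (\<Sum>t\<in>A. single t (lookup p t))" if "finite A" for A
    using that by (induction A) (auto simp: assms)
  then show ?thesis by (subst poly_mapping_eq_sum_single) simp
qed

lemma restrict_keys_single_mult:
  fixes p :: "('x, 'k::comm_ring_1) mpoly"
  shows "restrict_keys P (single s a * p) = single s a * restrict_keys (\<lambda>t. P (s + t)) p"
  by (induction p rule: poly_mapping_single_induct)
    (auto simp: restrict_keys_add distrib_left mult_single restrict_keys_single)

text \<open>The monomials outside \<open>P\<close> span an ideal and those inside are closed under
  multiplication, so restriction is a ring homomorphism. It yields the multiplicativity of constant
  terms and the substitution of zero for chosen variables.\<close>

lemma restrict_keys_mult:
  fixes p q :: "('x, 'k::comm_ring_1) mpoly"
  assumes "\<And>s t. P (s + t) \<longleftrightarrow> P s \<and> P t"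
  shows "restrict_keys P (p * q) = restrict_keys P p * restrict_keys P q"
proof -
  have [simp]: "restrict_keys (\<lambda>t. False) q = 0"
    by (rule restrict_keys_eq_0) simp
  show ?thesis
    by (induction p rule: poly_mapping_single_induct)
      (auto simp: restrict_keys_add distrib_right restrict_keys_single restrict_keys_single_mult assms)
qed

lemma lookup_mult_zero:
  fixes p q :: "('x, 'k::comm_ring_1) mpoly"
  shows "lookup (p * q) 0 = lookup p 0 * lookup q 0"
proof -
  have zero: "s + t = 0 \<longleftrightarrow> s = 0 \<and> t = 0" for s t :: "'x \<Rightarrow>\<^sub>0 nat"
    by (auto simp: poly_mapping_eq_iff lookup_add fun_eq_iff)
  have c: "single 0 (lookup p 0) = restrict_keys (\<lambda>t. t = 0) p" for p :: "('x, 'k) mpoly"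
    by (rule poly_mapping_eqI) (auto simp: lookup_restrict_keys lookup_single when_def)
  have "single (0 :: 'x \<Rightarrow>\<^sub>0 nat) (lookup (p * q) 0) = restrict_keys (\<lambda>t. t = 0) p * restrict_keys (\<lambda>t. t = 0) q"
    unfolding c by (rule restrict_keys_mult) (rule zero)
  also have "\<dots> = single 0 (lookup p 0 * lookup q 0)"
    unfolding c[symmetric] mult_single by simp
  finally show ?thesis by (metis lookup_single_eq)
qed

lemma single_eq_indet_mult:
  fixes t :: "'x \<Rightarrow>\<^sub>0 nat"
  assumes "lookup t x > 0"
  shows "single t a = indet x * single (t - single x 1) (a :: 'k::comm_ring_1)"
proof -
  have "t = single x 1 + (t - single x 1)"
    using assms by (intro poly_mapping_eqI) (auto simp: lookup_add lookup_minus lookup_single when_def)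
  then show ?thesis by (simp add: indet_def mult_single)
qed

section \<open>Degrees, homogeneous components and homogeneous ideals\<close>

lemma monom_degree_add: "monom_degree (s + t) = monom_degree s + monom_degree t"
  by (simp add: monom_degree_def lookup_add sum.distrib)

lemma monom_degree_single: "monom_degree (single x n) = n"
  by (simp add: monom_degree_def lookup_single when_def)

lemma monom_degree_zero_iff: "monom_degree t = 0 \<longleftrightarrow> t = 0"
  by (auto simp: monom_degree_def poly_mapping_eq_iff fun_eq_iff)

definition hom_part :: "int \<Rightarrow> ('x::finite, 'k::field) mpoly \<Rightarrow> ('x, 'k) mpoly" where
  "hom_part d = restrict_keys (\<lambda>t. int (monom_degree t) = d)"

lemma homogeneous_iff: "p \<in> homogeneous d \<longleftrightarrow> (\<forall>t. lookup p t \<noteq> 0 \<longrightarrow> int (monom_degree t) = d)"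
  by (auto simp: homogeneous_def in_keys_iff)

lemma homogeneous_hom_part: "hom_part d p \<in> homogeneous d"
  by (auto simp: hom_part_def homogeneous_def keys_restrict_keys)

lemma hom_part_homogeneous: "p \<in> homogeneous d \<Longrightarrow> hom_part d p = p"
  by (auto simp: hom_part_def homogeneous_def intro: restrict_keys_id)

lemma hom_part_zero [simp]: "hom_part d 0 = 0"
  by (simp add: hom_part_def)

lemma hom_part_add: "hom_part d (p + q) = hom_part d p + hom_part d q"
  by (simp add: hom_part_def restrict_keys_add)

lemma hom_part_diff: "hom_part d (p - q) = hom_part d p - hom_part d q"
  by (simp add: hom_part_def restrict_keys_diff)

lemma hom_part_uminus: "hom_part d (- p) = - hom_part d p"
  by (simp add: hom_part_def restrict_keys_uminus)

lemma hom_part_sum: "hom_part d (sum f A) = (\<Sum>x\<in>A. hom_part d (f x))"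
  by (simp add: hom_part_def restrict_keys_sum)

lemma hom_part_mult_homogeneous:
  assumes "b \<in> homogeneous m"
  shows "hom_part d (r * b) = hom_part (d - m) r * b"
proof (induction r rule: poly_mapping_single_induct)
  case (single t a q)
  have "hom_part d (single t a * b) = hom_part (d - m) (single t a) * b"
  proof (cases "int (monom_degree t) = d - m")
    case True
    then have "restrict_keys (\<lambda>u. int (monom_degree (t + u)) = d) b = b"
      using assms by (intro restrict_keys_id) (auto simp: homogeneous_def monom_degree_add)
    then show ?thesis using True
      by (simp add: hom_part_def restrict_keys_single_mult restrict_keys_single)
  next
    case False
    then have "restrict_keys (\<lambda>u. int (monom_degree (t + u)) = d) b = 0"
      using assms by (intro restrict_keys_eq_0) (auto simp: homogeneous_def monom_degree_add)
    then show ?thesis using False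
      by (simp add: hom_part_def restrict_keys_single_mult restrict_keys_single)
  qed
  then show ?case using single by (simp add: hom_part_add distrib_right)
qed simp

lemma homogeneous_zero [simp]: "0 \<in> homogeneous d"
  by (simp add: homogeneous_def)

lemma homogeneous_add: "p \<in> homogeneous d \<Longrightarrow> q \<in> homogeneous d \<Longrightarrow> p + q \<in> homogeneous d"
  using keys_add[of p q] by (auto simp: homogeneous_def)

lemma homogeneous_diff: "p \<in> homogeneous d \<Longrightarrow> q \<in> homogeneous d \<Longrightarrow> p - q \<in> homogeneous d"
  by (metis hom_part_diff hom_part_homogeneous homogeneous_hom_part)

lemma homogeneous_sum: "(\<And>x. x \<in> A \<Longrightarrow> f x \<in> homogeneous d) \<Longrightarrow> sum f A \<in> homogeneous d"
  by (induction A rule: infinite_finite_induct) (auto intro: homogeneous_add)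

lemma homogeneous_mult:
  assumes "p \<in> homogeneous d" "q \<in> homogeneous e"
  shows "p * q \<in> homogeneous (d + e)"
  using keys_mult[of p q] assms by (fastforce simp: homogeneous_def monom_degree_add)

lemma homogeneous_indet: "indet x \<in> homogeneous 1"
  by (simp add: homogeneous_def indet_def monom_degree_single)

lemma homogeneous_neg: "d < 0 \<Longrightarrow> p \<in> homogeneous d \<Longrightarrow> p = 0"
  by (rule ccontr) (auto simp: homogeneous_def keys_eq_empty[symmetric] simp del: keys_eq_empty)

lemma homogeneous_zero_degree: "p \<in> homogeneous 0 \<Longrightarrow> p = single 0 (lookup p 0)"
  by (rule poly_mapping_eqI) (auto simp: homogeneous_iff monom_degree_zero_iff lookup_single when_def)

lemma lookup_irrelevant_ideal: "p \<in> irrelevant_ideal \<Longrightarrow> lookup p 0 = 0"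
  unfolding irrelevant_ideal_def
proof (induction rule: ideal_gen_induct)
  case (step r b q)
  then have "lookup b 0 = 0"
    by (auto simp: indet_def lookup_single when_def poly_mapping_eq_iff fun_eq_iff)
  then show ?case using step by (simp add: lookup_add lookup_mult_zero)
qed simp

definition homogeneous_ideal :: "('x::finite, 'k::field) mpoly set \<Rightarrow> bool" where
  "homogeneous_ideal I \<longleftrightarrow> (\<exists>B. I = ideal_gen B \<and> (\<forall>b\<in>B. \<exists>m. b \<in> homogeneous m))"

lemma hom_part_in_ideal:
  assumes "homogeneous_ideal I" "p \<in> I"
  shows "hom_part d p \<in> I"
proof -
  obtain B where B: "I = ideal_gen B" "\<forall>b\<in>B. \<exists>m. b \<in> homogeneous m"
    using assms(1) by (auto simp: homogeneous_ideal_def)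
  have "p \<in> ideal_gen B" using assms(2) B by simp
  then have "hom_part d p \<in> ideal_gen B"
  proof (induction rule: ideal_gen_induct)
    case (step r b q)
    then obtain m where "b \<in> homogeneous m" using B by blast
    then show ?case using step
      by (auto simp: hom_part_add hom_part_mult_homogeneous intro!: ideal_gen_add intro: ideal_gen_mult[OF ideal_gen_base])
  qed simp
  then show ?thesis by (simp add: B)
qed

section \<open>The Koszul complex\<close>

text \<open>The indeterminates are ordered through \<open>to_nat\<close>; the sign is that of moving
  e_x from the front to its place in the ordered wedge product. As \<open>x\<close> itself is not
  counted, it is the same for \<open>S\<close> and \<open>insert x S\<close>.\<close>

definition koszul_sign :: "'x::finite \<Rightarrow> 'x set \<Rightarrow> 'r::comm_ring_1" where
  "koszul_sign x S = (- 1) ^ card {y \<in> S. to_nat y < to_nat x}"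

text \<open>A chain \<open>c\<close> stands for the sum of the \<open>c S\<close> e_S in the
  exterior algebra. \<open>contract x\<close> is interior multiplication by the dual of e_x and
  \<open>wedge x\<close> is exterior multiplication by e_x, both written on coefficients.\<close>

definition contract :: "'x::finite \<Rightarrow> ('x set \<Rightarrow> 'r::comm_ring_1) \<Rightarrow> 'x set \<Rightarrow> 'r" where
  "contract x c S = (if x \<in> S then 0 else koszul_sign x S * c (insert x S))"

definition wedge :: "'x::finite \<Rightarrow> ('x set \<Rightarrow> 'r::comm_ring_1) \<Rightarrow> 'x set \<Rightarrow> 'r" where
  "wedge x c S = (if x \<in> S then koszul_sign x S * c (S - {x}) else 0)"

definition koszul_bd :: "('x::finite set \<Rightarrow> ('x, 'k::field) mpoly) \<Rightarrow> 'x set \<Rightarrow> ('x, 'k) mpoly" where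
  "koszul_bd c S = (\<Sum>x\<in>UNIV. indet x * contract x c S)"

lemma koszul_sign_insert:
  assumes "x \<notin> S"
  shows "koszul_sign y (insert x S) =
    (if to_nat x < to_nat y then - koszul_sign y S else koszul_sign y S)"
proof (cases "to_nat x < to_nat y")
  case True
  then have "{z \<in> insert x S. to_nat z < to_nat y} = insert x {z \<in> S. to_nat z < to_nat y}"
    by auto
  then show ?thesis using True assms by (simp add: koszul_sign_def)
next
  case False
  then have "{z \<in> insert x S. to_nat z < to_nat y} = {z \<in> S. to_nat z < to_nat y}"
    by auto
  then show ?thesis using False by (simp add: koszul_sign_def)
qed

lemma koszul_sign_insert_self: "koszul_sign x (insert x S) = koszul_sign x S"
  by (cases "x \<in> S") (simp_all add: insert_absorb koszul_sign_insert)

lemma koszul_sign_square: "koszul_sign x S * (koszul_sign x S * p) = p"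
  by (simp add: koszul_sign_def flip: mult.assoc power_add)

lemma koszul_sign_cases:
  "koszul_sign x S = (1 :: 'r::comm_ring_1) \<or> koszul_sign x S = (- 1 :: 'r)"
  by (auto simp: koszul_sign_def minus_one_power_iff)

lemma koszul_sign_anticommute:
  assumes "x \<noteq> y" "x \<notin> S" "y \<notin> S"
  shows "koszul_sign x S * koszul_sign y (insert x S) = - (koszul_sign y S * koszul_sign x (insert y S))"
proof -
  have "to_nat x \<noteq> to_nat y" using assms by simp
  then show ?thesis using assms by (auto simp: koszul_sign_insert)
qed

lemma contract_anticommute:
  assumes "x \<noteq> y"
  shows "contract x (contract y c) S = - contract y (contract x c) S"
  using assms koszul_sign_anticommute[OF assms, of S, where ?'b = 'b]
  by (auto simp: contract_def insert_commute simp flip: mult.assoc)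

lemma contract_contract: "contract x (contract x c) S = 0"
  by (simp add: contract_def)

text \<open>The Clifford relation between interior and exterior multiplication.\<close>

lemma contract_wedge_anticommute:
  fixes b :: "'x::finite set \<Rightarrow> 'b::comm_ring_1"
  shows "contract x (wedge z b) S + wedge z (contract x b) S = (if x = z then b S else 0)"
proof (cases "x = z")
  case True
  then show ?thesis
    by (cases "z \<in> S")
      (auto simp: contract_def wedge_def koszul_sign_insert_self koszul_sign_square insert_absorb
        koszul_sign_insert_self[of z "S - {z}", symmetric])
next
  case False
  show ?thesis
  \<comment> \<open>In every other case both summands vanish.\<close>
  proof (cases "z \<in> S \<and> x \<notin> S")
    case True
    then obtain T where T: "S = insert z T" "z \<notin> T" "x \<notin> T"
      by (metis Diff_iff insert_Diff insert_iff)
    have "insert x (insert z T) - {z} = insert x T" "insert z T - {z} = T"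
      using T False by auto
    moreover have "koszul_sign z (insert x (insert z T)) = (koszul_sign z (insert x T) :: 'b)"
      by (metis insert_commute koszul_sign_insert_self)
    moreover have "koszul_sign x (insert z T) * koszul_sign z (insert x T) =
        - (koszul_sign z T * koszul_sign x T :: 'b)"
      using koszul_sign_anticommute[of z x T, where ?'b = 'b] T False
      by (auto simp: koszul_sign_insert split: if_splits)
    ultimately show ?thesis
      using False T
      by (simp add: contract_def wedge_def koszul_sign_insert_self flip: mult.assoc)
  qed (use False in \<open>auto simp: contract_def wedge_def\<close>)
qed

lemma contract_lin:
  "contract x (\<lambda>S. c S + e S) S = contract x c S + contract x e S"
  "contract x (\<lambda>S. c S - e S) S = contract x c S - contract x e S"
  "contract x (\<lambda>S. r * c S) S = r * contract x c S"
  by (simp_all add: contract_def algebra_simps)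

lemma contract_sum: "contract x (\<lambda>S. \<Sum>k\<in>A. f k S) S = (\<Sum>k\<in>A. contract x (f k) S)"
  by (simp add: contract_def sum_distrib_left)

lemma wedge_sum: "wedge x (\<lambda>S. \<Sum>k\<in>A. f k S) S = (\<Sum>k\<in>A. wedge x (f k) S)"
  by (simp add: wedge_def sum_distrib_left)

lemma wedge_mult: "wedge x (\<lambda>S. r * c S) S = r * wedge x c S"
  by (simp add: wedge_def algebra_simps)

lemma koszul_bd_lin:
  "koszul_bd (\<lambda>S. c S + e S) S = koszul_bd c S + koszul_bd e S"
  "koszul_bd (\<lambda>S. c S - e S) S = koszul_bd c S - koszul_bd e S"
  "koszul_bd (\<lambda>S. r * c S) S = r * koszul_bd c S"
  by (simp_all add: koszul_bd_def contract_lin distrib_left right_diff_distrib sum.distrib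
      sum_subtractf sum_distrib_left mult.left_commute)

lemma koszul_bd_mult_right: "koszul_bd (\<lambda>S. c S * r) S = koszul_bd c S * r"
  using koszul_bd_lin(3)[of r c S] by (simp add: mult.commute)

lemma koszul_bd_sum: "koszul_bd (\<lambda>S. \<Sum>k\<in>A. f k S) S = (\<Sum>k\<in>A. koszul_bd (f k) S)"
  by (simp add: koszul_bd_def contract_sum sum_distrib_left) (rule sum.swap)

lemma sum_alternating:
  fixes f :: "'a \<Rightarrow> 'a \<Rightarrow> 'b::ab_group_add"
  assumes "finite A" "\<And>x. f x x = 0" "\<And>x y. x \<noteq> y \<Longrightarrow> f x y = - f y x"
  shows "(\<Sum>x\<in>A. \<Sum>y\<in>A. f x y) = 0"
  using assms(1)
proof (induction A)
  case (insert a A)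
  have "(\<Sum>x\<in>A. f x a) = (\<Sum>x\<in>A. - f a x)"
    using insert by (intro sum.cong refl assms(3)) auto
  then show ?case using insert by (simp add: assms(2) sum.distrib sum_negf)
qed simp

lemma koszul_bd_bd: "koszul_bd (koszul_bd c) S = 0"
proof -
  have "koszul_bd (koszul_bd c) S =
      (\<Sum>x\<in>UNIV. \<Sum>y\<in>UNIV. indet x * (indet y * contract x (contract y c) S))"
    unfolding koszul_bd_def[abs_def] by (simp add: contract_sum contract_lin sum_distrib_left)
  also have "\<dots> = 0"
  proof (rule sum_alternating)
    fix x y :: 'a assume "x \<noteq> y"
    then show "indet x * (indet y * contract x (contract y c) S) =
        - (indet y * (indet x * contract y (contract x c) S))"
      using contract_anticommute[of x y c S] by (simp add: mult.left_commute)
  qed (simp_all add: contract_contract)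
  finally show ?thesis .
qed

text \<open>The Clifford relation, weighted by \<open>indet x\<close> and summed over
  \<open>x\<close>, survives only at \<open>x = z\<close>.\<close>

lemma koszul_homotopy: "koszul_bd (wedge z b) S + wedge z (koszul_bd b) S = indet z * b S"
proof -
  have "koszul_bd (wedge z b) S + wedge z (koszul_bd b) S =
      (\<Sum>x\<in>UNIV. indet x * (contract x (wedge z b) S + wedge z (contract x b) S))"
    unfolding koszul_bd_def[abs_def]
    by (simp add: wedge_sum wedge_mult distrib_left sum.distrib)
  also have "\<dots> = (\<Sum>x\<in>UNIV. if x = z then indet x * b S else 0)"
    by (intro sum.cong refl) (simp add: contract_wedge_anticommute)
  finally show ?thesis by simp
qed

lemma koszul_bd_in_ideal: "(\<And>S. c S \<in> ideal_gen B) \<Longrightarrow> koszul_bd c S \<in> ideal_gen B"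
  by (auto simp: koszul_bd_def contract_def intro!: ideal_gen_sum ideal_gen_mult)

lemma koszul_bd_zero: "koszul_bd (\<lambda>S. 0) S = (0 :: ('a::finite, 'b::field) mpoly)"
proof -
  have "contract x (\<lambda>S. 0) S = (0 :: ('a, 'b) mpoly)" for x
    by (simp add: contract_def)
  then show ?thesis by (simp add: koszul_bd_def)
qed

lemma koszul_bd_hom_part:
  fixes c :: "'x::finite set \<Rightarrow> ('x, 'k::field) mpoly"
  shows "koszul_bd (\<lambda>S. hom_part d (c S)) S = hom_part (d + 1) (koszul_bd c S)"
proof -
  have "hom_part (d + 1) (indet x * contract x c S) = indet x * contract x (\<lambda>S. hom_part d (c S)) S"
    for x
  proof -
    have "hom_part (d + 1) (indet x * contract x c S) = indet x * hom_part d (contract x c S)"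
      using hom_part_mult_homogeneous[OF homogeneous_indet, of "d + 1" "contract x c S" x]
      by (simp add: mult.commute)
    also have "hom_part d (contract x c S) = contract x (\<lambda>S. hom_part d (c S)) S"
      using koszul_sign_cases[of x S, where ?'r = "('x, 'k) mpoly"]
      by (auto simp: contract_def hom_part_uminus)
    finally show ?thesis .
  qed
  then show ?thesis by (simp add: koszul_bd_def hom_part_sum)
qed

text \<open>The boundary lowers exterior degree by one, so cutting a chain down to degree
  \<open>Suc p\<close> cuts its boundary down to degree \<open>p\<close>.\<close>

lemma koszul_bd_restrict_card:
  "koszul_bd (\<lambda>S. if card S = Suc p then c S else 0) S = (if card S = p then koszul_bd c S else 0)"
proof -
  have "contract x (\<lambda>S. if card S = Suc p then c S else 0) S = (if card S = p then contract x c S else 0)"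
    for x
    by (simp add: contract_def)
  then show ?thesis by (simp add: koszul_bd_def)
qed

text \<open>The chain \<open>c\<close> collects all homological degrees at once: the coefficient \<open>c S\<close> of
  \<open>\<And>\<^bsub>x\<in>S\<^esub> e\<^sub>x\<close> has degree \<open>d\<close> iff that term lies in internal degree
  \<open>card S + d\<close>, so the predicate says that the \<open>i\<close>-th Koszul homology of \<open>R/I\<close>
  vanishes in internal degrees above \<open>i + r\<close>.\<close>

definition koszul_regular :: "int \<Rightarrow> ('x::finite, 'k::field) mpoly set \<Rightarrow> bool" where
  "koszul_regular r I \<longleftrightarrow> (\<forall>d c. r < d \<longrightarrow> (\<forall>S. c S \<in> homogeneous d) \<longrightarrow>
     (\<forall>S. koszul_bd c S \<in> I) \<longrightarrow> (\<exists>e. \<forall>S. c S - koszul_bd e S \<in> I))"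

lemma koszul_regular_mono: "koszul_regular r I \<Longrightarrow> r \<le> s \<Longrightarrow> koszul_regular s I"
  unfolding koszul_regular_def by (meson le_less_trans)

text \<open>The boundary raises coefficient degrees by one and \<open>I\<close> is homogeneous, so
  the part of degree \<open>d - 1\<close> of any filling is again a filling.\<close>

lemma koszul_regular_homogeneousE:
  assumes "koszul_regular r I" "homogeneous_ideal I" "r < d"
    and "\<And>S. c S \<in> homogeneous d" "\<And>S. koszul_bd c S \<in> I"
  obtains e where "\<And>S. e S \<in> homogeneous (d - 1)" "\<And>S. c S - koszul_bd e S \<in> I"
proof -
  obtain e where e: "\<And>S. c S - koszul_bd e S \<in> I"
    using assms unfolding koszul_regular_def by blast
  have "c S - koszul_bd (\<lambda>S. hom_part (d - 1) (e S)) S \<in> I" for S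
    using hom_part_in_ideal[OF assms(2) e, of d S]
    by (simp add: koszul_bd_hom_part hom_part_diff hom_part_homogeneous[OF assms(4)])
  then show ?thesis by (rule that[OF homogeneous_hom_part])
qed

text \<open>From the long exact sequence of
  \<open>0 \<rightarrow> R/(I \<inter> J) \<rightarrow> R/I \<oplus> R/J \<rightarrow> R/(I + J) \<rightarrow> 0\<close>.\<close>

lemma koszul_regular_Int:
  assumes hom: "homogeneous_ideal (ideal_gen B)" "homogeneous_ideal (ideal_gen C)"
    and reg: "koszul_regular r (ideal_gen B)" "koszul_regular r (ideal_gen C)"
      "koszul_regular (r - 1) (ideal_gen (B \<union> C))"
  shows "koszul_regular r (ideal_gen B \<inter> ideal_gen C)"
  unfolding koszul_regular_def
proof (intro allI impI)
  fix d c
  assume d: "r < d" and c: "\<forall>S. c S \<in> homogeneous d"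
    and cyc: "\<forall>S. koszul_bd c S \<in> ideal_gen B \<inter> ideal_gen C"
  obtain e1 where e1: "\<And>S. e1 S \<in> homogeneous (d - 1)" "\<And>S. c S - koszul_bd e1 S \<in> ideal_gen B"
    by (rule koszul_regular_homogeneousE[OF reg(1) hom(1) d, of c]) (use c cyc in auto)
  obtain e2 where e2: "\<And>S. e2 S \<in> homogeneous (d - 1)" "\<And>S. c S - koszul_bd e2 S \<in> ideal_gen C"
    by (rule koszul_regular_homogeneousE[OF reg(2) hom(2) d, of c]) (use c cyc in auto)
  \<comment> \<open>Both fillings have boundary congruent to \<open>c\<close> modulo the sum of the
    ideals, so their difference is a cycle there. Its coefficients have degree \<open>d - 1\<close>,
    which exceeds \<open>r - 1\<close>.\<close>
  have "koszul_bd (\<lambda>S. e1 S - e2 S) S \<in> ideal_gen (B \<union> C)" for S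
  proof -
    have "c S - koszul_bd e2 S \<in> ideal_gen (B \<union> C)" "c S - koszul_bd e1 S \<in> ideal_gen (B \<union> C)"
      using e1(2)[of S] e2(2)[of S] ideal_gen_mono[of B "B \<union> C"] ideal_gen_mono[of C "B \<union> C"] by auto
    from ideal_gen_diff[OF this] show ?thesis by (simp add: koszul_bd_lin)
  qed
  moreover have "e1 S - e2 S \<in> homogeneous (d - 1)" for S
    using e1(1) e2(1) by (rule homogeneous_diff)
  ultimately obtain f where f: "\<And>S. e1 S - e2 S - koszul_bd f S \<in> ideal_gen (B \<union> C)"
    using reg(3)[unfolded koszul_regular_def, rule_format, of "d - 1" "\<lambda>S. e1 S - e2 S"] d by auto
  have "\<exists>a b. a \<in> ideal_gen B \<and> b \<in> ideal_gen C \<and> e1 S - e2 S - koszul_bd f S = a + b" for S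
    using ideal_gen_UnE[OF f[of S]] by metis
  then obtain a b where ab: "\<And>S. a S \<in> ideal_gen B" "\<And>S. b S \<in> ideal_gen C"
      "\<And>S. e1 S - e2 S - koszul_bd f S = a S + b S"
    by metis
  \<comment> \<open>One chain now serves both ideals: it differs from \<open>e1\<close> by
    \<open>a\<close> in the first ideal, and from \<open>e2\<close> by \<open>b\<close> in the
    second ideal plus a boundary.\<close>
  define e where "e S = e1 S - a S" for S
  have e: "e S = e2 S + b S + koszul_bd f S" for S
    using ab(3)[of S] by (simp add: e_def algebra_simps)
  have "c S - koszul_bd e S \<in> ideal_gen B" for S
    using ideal_gen_add[OF e1(2)[of S] koszul_bd_in_ideal[of a B S]] ab(1)
    by (simp add: e_def[abs_def] koszul_bd_lin algebra_simps)
  moreover have "c S - koszul_bd e S \<in> ideal_gen C" for S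
    using ideal_gen_diff[OF e2(2)[of S] koszul_bd_in_ideal[of b C S]] ab(2)
    by (simp add: e[abs_def] koszul_bd_lin koszul_bd_bd algebra_simps)
  ultimately show "\<exists>e. \<forall>S. c S - koszul_bd e S \<in> ideal_gen B \<inter> ideal_gen C"
    by blast
qed

text \<open>Multiplication by \<open>indet z\<close> is null-homotopic on the Koszul complex, so the Koszul homology
  of \<open>R/I\<close> embeds into that of \<open>R/(I, indet z)\<close>.\<close>

lemma koszul_regular_nonzerodivisor:
  assumes reg: "koszul_regular r (ideal_gen (insert (indet z) B))"
    and nzd: "\<And>p. indet z * p \<in> ideal_gen B \<Longrightarrow> p \<in> ideal_gen B"
  shows "koszul_regular r (ideal_gen B)"
  unfolding koszul_regular_def
proof (intro allI impI)
  fix d c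
  assume d: "r < d" and c: "\<forall>S. c S \<in> homogeneous d" and cyc: "\<forall>S. koszul_bd c S \<in> ideal_gen B"
  have "\<forall>S. koszul_bd c S \<in> ideal_gen (insert (indet z) B)"
    using cyc ideal_gen_mono[of B "insert (indet z) B"] by auto
  then obtain e where e: "\<And>S. c S - koszul_bd e S \<in> ideal_gen (insert (indet z) B)"
    using reg c d unfolding koszul_regular_def by blast
  have "\<exists>a b. a \<in> ideal_gen B \<and> c S - koszul_bd e S = a + indet z * b" for S
    using ideal_gen_insertE[OF e[of S]] by metis
  then obtain a b where ab: "\<And>S. a S \<in> ideal_gen B" "\<And>S. c S - koszul_bd e S = a S + indet z * b S"
    by metis
  have zb: "(\<lambda>S. indet z * b S) = (\<lambda>S. c S - koszul_bd e S - a S)"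
    using ab(2) by (simp add: fun_eq_iff)
  \<comment> \<open>\<open>b\<close> is a cycle modulo the ideal: \<open>indet z * b\<close> equals
    \<open>c - koszul_bd e - a\<close>, whose boundary lies in the ideal, and \<open>indet z\<close>
    can be cancelled.\<close>
  have "indet z * koszul_bd b S \<in> ideal_gen B" for S
  proof -
    have "indet z * koszul_bd b S = koszul_bd (\<lambda>S. c S - koszul_bd e S - a S) S"
      unfolding zb[symmetric] koszul_bd_lin(3) ..
    also have "\<dots> = koszul_bd c S - koszul_bd a S"
      by (simp add: koszul_bd_lin koszul_bd_bd)
    also have "\<dots> \<in> ideal_gen B"
      using cyc koszul_bd_in_ideal[of a B S] ab(1) by (intro ideal_gen_diff) auto
    finally show ?thesis .
  qed
  then have b: "koszul_bd b S \<in> ideal_gen B" for S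
    by (rule nzd)
  \<comment> \<open>By the homotopy, the boundary of \<open>wedge z b\<close> is
    \<open>indet z * b\<close> up to \<open>wedge z (koszul_bd b)\<close>, which lies in the
    ideal.\<close>
  have "c S - koszul_bd (\<lambda>S. e S + wedge z b S) S \<in> ideal_gen B" for S
  proof -
    have "c S - koszul_bd (\<lambda>S. e S + wedge z b S) S =
        (c S - koszul_bd e S) - koszul_bd (wedge z b) S"
      unfolding koszul_bd_lin(1) by (rule diff_diff_eq[symmetric])
    also have "\<dots> = a S + wedge z (koszul_bd b) S"
      unfolding ab(2) koszul_homotopy[of z b S, symmetric] by simp
    also have "\<dots> \<in> ideal_gen B"
      using ab(1) b by (auto simp: wedge_def intro!: ideal_gen_add ideal_gen_mult)
    finally show ?thesis .
  qed
  then show "\<exists>e. \<forall>S. c S - koszul_bd e S \<in> ideal_gen B" by blast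
qed

section \<open>Ideals generated by variables and clique binomials\<close>

definition edge_binomial :: "'v \<Rightarrow> 'v \<Rightarrow> ('v + 'v, 'k::comm_ring_1) mpoly" where
  "edge_binomial i j = indet (Inl i) * indet (Inr j) - indet (Inl j) * indet (Inr i)"

text \<open>\<open>E\<close> consists of ordered pairs; loops and reversed pairs do no harm because
  f_ii = 0 and f_ji = -f_ij. Variables specialised to zero stay in the ring and enter the ideal
  through \<open>W\<close>.\<close>

definition mixed_gens :: "('v + 'v) set \<Rightarrow> ('v \<times> 'v) set \<Rightarrow> ('v + 'v, 'k::comm_ring_1) mpoly set" where
  "mixed_gens W E = indet ` W \<union> {edge_binomial i j | i j. (i, j) \<in> E}"

abbreviation mixed_ideal :: "('v + 'v) set \<Rightarrow> ('v \<times> 'v) set \<Rightarrow> ('v + 'v, 'k::comm_ring_1) mpoly set" where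
  "mixed_ideal W E \<equiv> ideal_gen (mixed_gens W E)"

definition clique_rel :: "'v set set \<Rightarrow> ('v \<times> 'v) set" where
  "clique_rel A = (\<Union>C\<in>A. C \<times> C)"

lemma clique_relI: "C \<in> A \<Longrightarrow> i \<in> C \<Longrightarrow> j \<in> C \<Longrightarrow> (i, j) \<in> clique_rel A"
  by (auto simp: clique_rel_def)

lemma indet_in_mixed: "z \<in> W \<Longrightarrow> indet z \<in> mixed_ideal W E"
  by (intro ideal_gen_base) (simp add: mixed_gens_def)

lemma edge_binomial_in_mixed: "(i, j) \<in> E \<Longrightarrow> edge_binomial i j \<in> mixed_ideal W E"
  by (intro ideal_gen_base) (auto simp: mixed_gens_def)

lemma mixed_ideal_subsetI:
  assumes "\<And>z. z \<in> W \<Longrightarrow> indet z \<in> ideal_gen B"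
    and "\<And>i j. (i, j) \<in> E \<Longrightarrow> edge_binomial i j \<in> ideal_gen B"
  shows "mixed_ideal W E \<subseteq> ideal_gen B"
  by (rule ideal_gen_subsetI) (auto simp: mixed_gens_def assms)

lemma mixed_ideal_mono: "W \<subseteq> W' \<Longrightarrow> E \<subseteq> E' \<Longrightarrow> mixed_ideal W E \<subseteq> mixed_ideal W' E'"
  by (intro ideal_gen_mono) (auto simp: mixed_gens_def)

lemma mixed_gens_Un: "mixed_gens W E \<union> mixed_gens W' E' = mixed_gens (W \<union> W') (E \<union> E')"
  by (auto simp: mixed_gens_def)

lemma mixed_gens_insert: "mixed_gens (insert z W) E = insert (indet z) (mixed_gens W E)"
  by (auto simp: mixed_gens_def)

lemma mixed_gensE [consumes 1, case_names var edge]: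
  assumes "b \<in> mixed_gens W E"
  obtains z where "b = indet z" "z \<in> W"
  | i j where "b = edge_binomial i j" "(i, j) \<in> E"
  using assms by (auto simp: mixed_gens_def)

lemma edge_binomial_refl: "edge_binomial i i = 0"
  by (simp add: edge_binomial_def mult.commute)

lemma edge_binomial_swap: "edge_binomial j i = - edge_binomial i j"
  by (simp add: edge_binomial_def)

lemma homogeneous_mixed: "homogeneous_ideal (mixed_ideal W E)"
proof -
  have "edge_binomial i j \<in> homogeneous 2" for i j
    using homogeneous_mult[OF homogeneous_indet homogeneous_indet]
    by (fastforce simp: edge_binomial_def intro!: homogeneous_diff)
  then show ?thesis
    unfolding homogeneous_ideal_def mixed_gens_def using homogeneous_indet by blast
qed

section \<open>Membership in clique ideals, decided by coefficient sums over classes of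
  monomials\<close>

definition coeff_sum :: "('a \<Rightarrow>\<^sub>0 'b::comm_monoid_add) \<Rightarrow> 'b" where
  "coeff_sum p = (\<Sum>t\<in>keys p. lookup p t)"

lemma coeff_sum_zero [simp]: "coeff_sum 0 = 0"
  by (simp add: coeff_sum_def)

lemma coeff_sum_single [simp]: "coeff_sum (single t a) = a"
  by (simp add: coeff_sum_def)

lemma coeff_sum_add: "coeff_sum (p + q) = coeff_sum p + coeff_sum q"
  unfolding coeff_sum_def by (rule setsum_keys_plus_distrib) simp_all

lemma coeff_sum_diff:
  fixes p q :: "'a \<Rightarrow>\<^sub>0 'b::ab_group_add"
  shows "coeff_sum (p - q) = coeff_sum p - coeff_sum q"
  using coeff_sum_add[of "p - q" q] by simp

lemma coeff_sum_indet_mult: "coeff_sum (indet z * p) = coeff_sum p"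
  by (induction p rule: poly_mapping_single_induct)
    (auto simp: indet_def distrib_left coeff_sum_add mult_single)

text \<open>Two exponent vectors are in the same class iff they have the same image under the
  parametrisation \<open>x\<^sub>i \<mapsto> s\<^sub>C a\<^sub>i\<close>, \<open>y\<^sub>i \<mapsto> t\<^sub>C a\<^sub>i\<close> for \<open>i \<in> C \<in> A\<close>, all other variables
  being fixed. The ideal of the cliques \<open>A\<close> is the kernel of this parametrisation.\<close>

definition same_class :: "'v set set \<Rightarrow> ('v::finite + 'v \<Rightarrow>\<^sub>0 nat) \<Rightarrow> ('v + 'v \<Rightarrow>\<^sub>0 nat) \<Rightarrow> bool" where
  "same_class A s t \<longleftrightarrow>
     (\<forall>i. lookup s (Inl i) + lookup s (Inr i) = lookup t (Inl i) + lookup t (Inr i)) \<and>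
     (\<forall>i. i \<notin> \<Union>A \<longrightarrow> lookup s (Inl i) = lookup t (Inl i)) \<and>
     (\<forall>C\<in>A. (\<Sum>i\<in>C. lookup s (Inl i)) = (\<Sum>i\<in>C. lookup t (Inl i)))"

lemma same_class_refl: "same_class A s s"
  by (simp add: same_class_def)

lemma same_class_add_left: "same_class A (u + s) (u + t) \<longleftrightarrow> same_class A s t"
  by (simp add: same_class_def lookup_add sum.distrib)

lemma sum_lookup_add_single:
  fixes s :: "'v::finite + 'v \<Rightarrow>\<^sub>0 nat"
  shows "(\<Sum>i\<in>C. lookup (s + single (Inl k) 1 + single (Inr l) 1) (Inl i)) =
    (\<Sum>i\<in>C. lookup s (Inl i)) + (if k \<in> C then 1 else 0)"
  by (simp add: lookup_add lookup_single when_def sum.distrib)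

lemma same_class_swap:
  assumes "C \<in> A" "i \<in> C" "j \<in> C" "pairwise disjnt A"
  shows "same_class A (s + single (Inl i) 1 + single (Inr j) 1) (s + single (Inl j) 1 + single (Inr i) 1)"
proof -
  have "i \<in> C' \<longleftrightarrow> j \<in> C'" if "C' \<in> A" for C'
    using assms that by (auto simp: pairwise_def disjnt_iff)
  then show ?thesis using assms
    unfolding same_class_def sum_lookup_add_single
    by (auto simp: lookup_add lookup_single when_def)
qed

lemma same_class_sym: "same_class A s t \<Longrightarrow> same_class A t s"
  by (simp add: same_class_def)

lemma same_class_trans: "same_class A s t \<Longrightarrow> same_class A t u \<Longrightarrow> same_class A s u"
  by (simp add: same_class_def)

lemma single_mult_edge_binomial:
  "single s a * edge_binomial i j =
    single (s + single (Inl i) 1 + single (Inr j) 1) a - single (s + single (Inl j) 1 + single (Inr i) 1) a"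
  by (simp add: edge_binomial_def indet_def mult_single right_diff_distrib add.assoc)

text \<open>The setting in which class sums detect membership: the clique of a vertex is unique, and
  exchanging the two terms of a clique binomial never touches a variable of
  \<open>W\<close>.\<close>

definition admissible :: "('v + 'v) set \<Rightarrow> 'v set set \<Rightarrow> bool" where
  "admissible W A \<longleftrightarrow> pairwise disjnt A \<and> (\<forall>i\<in>\<Union>A. Inl i \<notin> W \<and> Inr i \<notin> W)"

text \<open>Set the variables in \<open>W\<close> to zero and apply the parametrisation: this is the
  coefficient of the result at the image of the monomial \<open>u\<close>.\<close>

definition class_sum ::
  "('v::finite + 'v) set \<Rightarrow> 'v set set \<Rightarrow> ('v + 'v \<Rightarrow>\<^sub>0 nat) \<Rightarrow> ('v + 'v, 'k::comm_ring_1) mpoly \<Rightarrow> 'k" where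
  "class_sum W A u p =
     coeff_sum (restrict_keys (\<lambda>t. (\<forall>z\<in>W. lookup t z = 0) \<and> same_class A u t) p)"

lemma class_sum_lin:
  "class_sum W A u (p + q) = class_sum W A u p + class_sum W A u q"
  "class_sum W A u (p - q) = class_sum W A u p - class_sum W A u q"
  by (simp_all add: class_sum_def restrict_keys_add restrict_keys_diff coeff_sum_add coeff_sum_diff)

lemma class_sum_single:
  "class_sum W A u (single t a) = (if (\<forall>z\<in>W. lookup t z = 0) \<and> same_class A u t then a else 0)"
  by (simp add: class_sum_def restrict_keys_single)

lemma class_sum_zero [simp]: "class_sum W A u 0 = 0"
  by (simp add: class_sum_def)

text \<open>A monomial multiple of a generator either contains a variable of \<open>W\<close> or is
  a difference of two monomials of one class, both or neither of which avoid
  \<open>W\<close>.\<close>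

lemma class_sum_mixed:
  assumes adm: "admissible W A" and "p \<in> mixed_ideal W (clique_rel A)"
  shows "class_sum W A u p = 0"
  using assms(2)
proof (induction rule: ideal_gen_induct)
  case (step r b q)
  have "class_sum W A u (single s a * b) = 0" for s a
    using step(1)
  proof (cases rule: mixed_gensE)
    case (var z)
    then show ?thesis
      by (auto simp: indet_def mult_single class_sum_single lookup_add)
  next
    case (edge i j)
    then obtain C where C: "C \<in> A" "i \<in> C" "j \<in> C" by (auto simp: clique_rel_def)
    let ?s = "s + single (Inl i) 1 + single (Inr j) 1" and ?t = "s + single (Inl j) 1 + single (Inr i) 1"
    have "Inl i \<notin> W" "Inr i \<notin> W" "Inl j \<notin> W" "Inr j \<notin> W"
      using adm C by (auto simp: admissible_def)
    then have "(\<forall>z\<in>W. lookup ?s z = 0) \<longleftrightarrow> (\<forall>z\<in>W. lookup ?t z = 0)"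
      by (auto simp: lookup_add lookup_single when_def)
    moreover have "same_class A ?s ?t"
      using adm C by (intro same_class_swap) (auto simp: admissible_def)
    then have "same_class A u ?s \<longleftrightarrow> same_class A u ?t"
      by (meson same_class_sym same_class_trans)
    ultimately show ?thesis
      by (simp only: edge(1) single_mult_edge_binomial class_sum_lin class_sum_single) simp
  qed
  then have "class_sum W A u (r * b) = 0"
    by (induction r rule: poly_mapping_single_induct) (simp_all add: distrib_right class_sum_lin)
  then show ?case using step by (simp add: class_sum_lin)
qed simp

lemma sum_le_obtain_less:
  fixes f g :: "'a \<Rightarrow> nat"
  assumes "finite C" "sum f C = sum g C" "i \<in> C" "g i < f i"
  obtains j where "j \<in> C" "f j < g j"
proof (rule ccontr)
  assume "\<not> thesis"
  then have "\<forall>j\<in>C. g j \<le> f j" using that by (meson not_le)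
  then have "sum g C < sum f C" using assms by (intro sum_strict_mono_ex1) auto
  then show False using assms by simp
qed

text \<open>Monomials of one class are connected by swaps x_i y_j -> x_j y_i inside cliques. The
  induction is on the total excess of the x-exponents of \<open>s\<close> over those of
  \<open>t\<close>; truncated subtraction counts only the positive differences.\<close>

lemma same_class_diff_in_ideal:
  assumes disj: "pairwise disjnt A"
  shows "same_class A s t \<Longrightarrow> single s (1::'k::comm_ring_1) - single t 1 \<in> mixed_ideal W (clique_rel A)"
proof (induction "\<Sum>i\<in>UNIV. lookup s (Inl i) - lookup t (Inl i)" arbitrary: s rule: less_induct)
  case less
  show ?case
  proof (cases "\<exists>i. lookup t (Inl i) < lookup s (Inl i)")
    case False
    have "lookup s (Inl j) = lookup t (Inl j)" for j
    proof (rule ccontr)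
      assume neq: "lookup s (Inl j) \<noteq> lookup t (Inl j)"
      then have lt: "lookup s (Inl j) < lookup t (Inl j)" using False by (meson linorder_neqE_nat)
      obtain C where C: "C \<in> A" "j \<in> C" using less.prems neq unfolding same_class_def by blast
      obtain k where "lookup t (Inl k) < lookup s (Inl k)"
        by (rule sum_le_obtain_less[of C "\<lambda>i. lookup t (Inl i)" "\<lambda>i. lookup s (Inl i)" j])
          (use C lt less.prems in \<open>auto simp: same_class_def\<close>)
      then show False using False by blast
    qed
    moreover from this have "lookup s (Inr j) = lookup t (Inr j)" for j
      using less.prems unfolding same_class_def by (metis add_left_cancel)
    ultimately have "lookup s z = lookup t z" for z by (cases z) auto
    then have "s = t" by (rule poly_mapping_eqI)
    then show ?thesis by simp
  next
    case True
    then obtain i where i: "lookup t (Inl i) < lookup s (Inl i)" by blast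
    then obtain C where C: "C \<in> A" "i \<in> C" using less.prems by (fastforce simp: same_class_def)
    obtain j where j: "j \<in> C" "lookup s (Inl j) < lookup t (Inl j)"
      by (rule sum_le_obtain_less[of C "\<lambda>i. lookup s (Inl i)" "\<lambda>i. lookup t (Inl i)" i])
        (use C i less.prems in \<open>auto simp: same_class_def\<close>)
    \<comment> \<open>The total exponents at \<open>j\<close> agree, so the deficit in x_j is a
      surplus in y_j.\<close>
    have "lookup s (Inr j) > 0"
      using less.prems j(2) unfolding same_class_def
      by (metis add.right_neutral gr0I not_add_less1)
    define s0 where "s0 = s - single (Inl i) 1 - single (Inr j) 1"
    define s' where "s' = s0 + single (Inl j) 1 + single (Inr i) 1"
    have ij: "i \<noteq> j" using i j by auto
    have s: "s = s0 + single (Inl i) 1 + single (Inr j) 1"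
      unfolding s0_def using i \<open>lookup s (Inr j) > 0\<close>
      by (intro poly_mapping_eqI) (auto simp: lookup_add lookup_minus lookup_single when_def)
    have "lookup s' (Inl k) - lookup t (Inl k) \<le> lookup s (Inl k) - lookup t (Inl k)" for k
      using ij j(2) unfolding s'_def s by (auto simp: lookup_add lookup_single when_def)
    moreover have "lookup s' (Inl i) - lookup t (Inl i) < lookup s (Inl i) - lookup t (Inl i)"
      using ij i unfolding s'_def s by (auto simp: lookup_add lookup_single when_def)
    ultimately have "(\<Sum>k\<in>UNIV. lookup s' (Inl k) - lookup t (Inl k)) <
        (\<Sum>k\<in>UNIV. lookup s (Inl k) - lookup t (Inl k))"
      by (intro sum_strict_mono_ex1) auto
    moreover have "same_class A s' t"
      using same_class_swap[OF C(1) j(1) C(2) disj] less.prems unfolding s'_def s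
      by (rule same_class_trans)
    ultimately have "single s' (1::'k) - single t 1 \<in> mixed_ideal W (clique_rel A)"
      by (rule less.hyps)
    moreover have "single s (1::'k) - single s' 1 \<in> mixed_ideal W (clique_rel A)"
      unfolding s s'_def single_mult_edge_binomial[symmetric]
      using clique_relI[OF C j(1)] by (intro ideal_gen_mult edge_binomial_in_mixed)
    ultimately have "(single s (1::'k) - single s' 1) + (single s' 1 - single t 1) \<in> mixed_ideal W (clique_rel A)"
      by (intro ideal_gen_add)
    then show ?thesis by simp
  qed
qed

text \<open>Induction on the number of monomials. A monomial containing a variable of
  \<open>W\<close> lies in the ideal; any other shares its class with a second monomial of
  \<open>p\<close>, as the class sum vanishes, and its coefficient can be moved there.\<close>

lemma mixed_if_class_sum:
  assumes adm: "admissible W A" and "\<And>u. class_sum W A u p = 0"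
  shows "p \<in> mixed_ideal W (clique_rel A)"
  using assms(2)
proof (induction "card (keys p)" arbitrary: p rule: less_induct)
  case less
  show ?case
  proof (cases "keys p = {}")
    case True
    then show ?thesis by simp
  next
    case False
    then obtain t where t: "t \<in> keys p" by blast
    define a where "a = lookup p t"
    have a: "a \<noteq> 0" using t by (simp add: a_def in_keys_iff)
    obtain q where q: "q \<in> mixed_ideal W (clique_rel A)" "keys (p - q) \<subseteq> keys p - {t}"
    proof (cases "\<exists>z\<in>W. lookup t z > 0")
      case True
      then obtain z where z: "z \<in> W" "lookup t z > 0" by blast
      have "single t a \<in> mixed_ideal W (clique_rel A)"
        unfolding single_eq_indet_mult[OF z(2)] using z(1) by (intro ideal_gen_mult_right indet_in_mixed)
      moreover have "keys (p - single t a) \<subseteq> keys p - {t}"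
        by (auto simp: in_keys_iff lookup_minus lookup_single a_def when_def split: if_splits)
      ultimately show ?thesis by (rule that)
    next
      case False
      have "\<exists>t'\<in>keys p. t' \<noteq> t \<and> same_class A t t'"
      proof (rule ccontr)
        assume "\<not> ?thesis"
        then have "restrict_keys (\<lambda>t'. (\<forall>z\<in>W. lookup t' z = 0) \<and> same_class A t t') p = single t a"
          using False
          by (intro poly_mapping_eqI)
            (auto simp: lookup_restrict_keys lookup_single when_def a_def in_keys_iff same_class_refl)
        then have "class_sum W A t p = a" by (simp add: class_sum_def)
        then show False using less.prems a by simp
      qed
      then obtain t' where t': "t' \<in> keys p" "t' \<noteq> t" "same_class A t t'" by blast
      have "single 0 a * (single t 1 - single t' 1) \<in> mixed_ideal W (clique_rel A)"
        using adm t'(3) by (intro ideal_gen_mult same_class_diff_in_ideal) (simp_all add: admissible_def)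
      then have "single t a - single t' a \<in> mixed_ideal W (clique_rel A)"
        by (simp add: right_diff_distrib mult_single)
      moreover have "keys (p - (single t a - single t' a)) \<subseteq> keys p - {t}"
        using t' by (auto simp: in_keys_iff lookup_minus lookup_single a_def when_def split: if_splits)
      ultimately show ?thesis by (rule that)
    qed
    have "card (keys (p - q)) < card (keys p)"
      using q(2) t by (intro psubset_card_mono) auto
    moreover have "class_sum W A u (p - q) = 0" for u
      using less.prems class_sum_mixed[OF adm q(1)] by (simp add: class_sum_lin)
    ultimately have "p - q \<in> mixed_ideal W (clique_rel A)" by (rule less.hyps)
    from ideal_gen_add[OF this q(1)] show ?thesis by simp
  qed
qed

text \<open>Multiplication by \<open>indet z\<close> shifts all exponents by one vector; this
  preserves classes and, as \<open>z\<close> is not in \<open>W\<close>, the avoidance of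
  \<open>W\<close>. So the class sums of \<open>p\<close> occur among those of the product.\<close>

lemma mixed_ideal_nonzerodivisor:
  fixes p :: "('v::finite + 'v, 'k::comm_ring_1) mpoly"
  assumes adm: "admissible W A" and z: "z \<notin> W"
    and "indet z * p \<in> mixed_ideal W (clique_rel A)"
  shows "p \<in> mixed_ideal W (clique_rel A)"
proof (rule mixed_if_class_sum[OF adm])
  fix u
  have *: "(\<forall>w\<in>W. lookup (single z 1 + t) w = 0) \<longleftrightarrow> (\<forall>w\<in>W. lookup t w = 0)" for t
    using z by (auto simp: lookup_add lookup_single when_def)
  have "class_sum W A (single z 1 + u) (indet z * p) = coeff_sum (indet z *
      restrict_keys (\<lambda>t. (\<forall>w\<in>W. lookup t w = 0) \<and> same_class A u t) p)"
    unfolding class_sum_def indet_def restrict_keys_single_mult same_class_add_left * ..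
  then show "class_sum W A u p = 0"
    using class_sum_mixed[OF adm assms(3)] by (simp add: coeff_sum_indet_mult class_sum_def)
qed

section \<open>Regularity of clique ideals and clique covers\<close>

lemma clique_rel_empty [simp]: "clique_rel {} = {}"
  by (simp add: clique_rel_def)

text \<open>Adjoining the remaining variables one by one as nonzerodivisors leads to the residue
  field, where every chain with coefficients of positive degree is zero. The case
  \<open>W = {}\<close> is the acyclicity of the Koszul complex of R in positive coefficient
  degrees.\<close>

lemma koszul_regular_variables: "koszul_regular 0 (mixed_ideal W {} :: ('v::finite + 'v, 'k::field) mpoly set)"
proof (induction "card (- W)" arbitrary: W rule: less_induct)
  case less
  show ?case
  proof (cases "W = UNIV")
    case True
    show ?thesis unfolding koszul_regular_def
    proof (intro allI impI exI)
      fix d and c :: "('v + 'v) set \<Rightarrow> ('v + 'v, 'k) mpoly" and S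
      assume d: "0 < d" and c: "\<forall>S. c S \<in> homogeneous d"
      have "(\<Sum>t\<in>keys (c S). single t (lookup (c S) t)) \<in> mixed_ideal W {}"
      proof (rule ideal_gen_sum)
        fix t assume "t \<in> keys (c S)"
        then have "monom_degree t \<noteq> 0" using c d by (fastforce simp: homogeneous_def)
        then obtain z where "lookup t z > 0" by (auto simp: monom_degree_def)
        then show "single t (lookup (c S) t) \<in> mixed_ideal W {}"
          unfolding single_eq_indet_mult[OF \<open>lookup t z > 0\<close>]
          by (intro ideal_gen_mult_right indet_in_mixed) (simp add: True)
      qed
      then show "c S - koszul_bd (\<lambda>_. 0) S \<in> mixed_ideal W {}"
        by (simp add: koszul_bd_zero flip: poly_mapping_eq_sum_single)
    qed
  next
    case False
    then obtain z where z: "z \<notin> W" by blast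
    then have "card (- insert z W) < card (- W)"
      by (intro psubset_card_mono) auto
    then have "koszul_regular 0 (mixed_ideal (insert z W) {} :: ('v + 'v, 'k) mpoly set)" by (rule less)
    then show ?thesis
      unfolding mixed_gens_insert
    proof (rule koszul_regular_nonzerodivisor)
      fix p :: "('v + 'v, 'k) mpoly"
      assume "indet z * p \<in> mixed_ideal W {}"
      then show "p \<in> mixed_ideal W {}"
        using mixed_ideal_nonzerodivisor[of W "{}" z p] z by (simp add: admissible_def)
    qed
  qed
qed

lemma edge_binomial_in_idealI:
  assumes "indet (Inl i) \<in> ideal_gen B \<and> indet (Inl j) \<in> ideal_gen B \<or>
    indet (Inl i) \<in> ideal_gen B \<and> indet (Inr i) \<in> ideal_gen B \<or>
    indet (Inl j) \<in> ideal_gen B \<and> indet (Inr j) \<in> ideal_gen B"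
  shows "edge_binomial i j \<in> ideal_gen B"
  using assms unfolding edge_binomial_def
  by (auto intro!: ideal_gen_diff intro: ideal_gen_mult ideal_gen_mult_right)

lemma edge_binomial_in_mixedI:
  assumes "(i, j) \<in> E \<or> Inl i \<in> W \<and> Inl j \<in> W \<or> Inl i \<in> W \<and> Inr i \<in> W \<or> Inl j \<in> W \<and> Inr j \<in> W"
  shows "edge_binomial i j \<in> mixed_ideal W E"
  using assms edge_binomial_in_idealI[of i _ j] indet_in_mixed edge_binomial_in_mixed by metis

text \<open>Modulo x_n the binomial f_in becomes x_i y_n, so the ideal splits into the case y_n = 0
  and the case where all x_i with i in \<open>C\<close> vanish.\<close>

lemma clique_ideal_decomposition:
  fixes W :: "('v::finite + 'v) set"
  assumes adm: "admissible W A" and C: "C \<in> A" "n \<in> C"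
  shows "mixed_ideal (insert (Inr n) (insert (Inl n) W)) (clique_rel (insert (C - {n}) (A - {C}))) \<inter>
      mixed_ideal (W \<union> Inl ` C) (clique_rel (A - {C})) =
    (mixed_ideal (insert (Inl n) W) (clique_rel A) :: ('v + 'v, 'k::comm_ring_1) mpoly set)"
    (is "?I1 \<inter> ?I2 = ?I")
proof
  have sub: "clique_rel (A - {C}) \<subseteq> clique_rel A" by (auto simp: clique_rel_def)
  have "edge_binomial i j \<in> ?I1 \<inter> ?I2" if "(i, j) \<in> clique_rel A" for i j
  proof (cases "(i, j) \<in> clique_rel (A - {C})")
    case True
    then show ?thesis by (auto simp: clique_rel_def intro!: edge_binomial_in_mixed)
  next
    case False
    then have ij: "i \<in> C" "j \<in> C" using that by (auto simp: clique_rel_def)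
    show ?thesis
      using ij clique_relI[of "C - {n}" "insert (C - {n}) (A - {C})" i j]
      by (intro IntI edge_binomial_in_mixedI) auto
  qed
  then show "?I \<subseteq> ?I1 \<inter> ?I2"
    using C by (intro Int_greatest mixed_ideal_subsetI) (auto intro!: indet_in_mixed)
  show "?I1 \<inter> ?I2 \<subseteq> ?I"
  proof
    \<comment> \<open>Splitting off the generator y_n of the first ideal leaves y_n r in the second.
      There y_n is a nonzerodivisor, so \<open>r\<close> lies in the second ideal, and y_n times
      that ideal is contained in \<open>?I\<close>.\<close>
    fix p assume p: "p \<in> ?I1 \<inter> ?I2"
    obtain q r where q: "q \<in> mixed_ideal (insert (Inl n) W) (clique_rel (insert (C - {n}) (A - {C})))"
      and pq: "p = q + indet (Inr n) * r"
      using p unfolding mixed_gens_insert[of "Inr n"] by (blast elim: ideal_gen_insertE)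
    have "mixed_ideal (insert (Inl n) W) (clique_rel (insert (C - {n}) (A - {C}))) \<subseteq> ?I"
      using C by (intro mixed_ideal_mono) (auto simp: clique_rel_def)
    then have "q \<in> ?I" using q by blast
    moreover have "mixed_ideal (insert (Inl n) W) (clique_rel (insert (C - {n}) (A - {C}))) \<subseteq> ?I2"
    proof (rule mixed_ideal_subsetI)
      fix i j assume "(i, j) \<in> clique_rel (insert (C - {n}) (A - {C}))"
      then consider "(i, j) \<in> clique_rel (A - {C})" | "i \<in> C" "j \<in> C" by (auto simp: clique_rel_def)
      then show "edge_binomial i j \<in> ?I2"
        by cases (intro edge_binomial_in_mixedI, auto)+
    qed (use C in \<open>auto intro!: indet_in_mixed\<close>)
    then have "p - q \<in> ?I2" using p q by (intro ideal_gen_diff) auto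
    then have "indet (Inr n) * r \<in> ?I2" by (simp add: pq)
    then have "r \<in> ?I2"
    proof (rule mixed_ideal_nonzerodivisor[rotated 2])
      show "admissible (W \<union> Inl ` C) (A - {C})"
        using adm C by (auto simp: admissible_def pairwise_def disjnt_iff)
      show "Inr n \<notin> W \<union> Inl ` C" using adm C by (auto simp: admissible_def)
    qed
    then have "indet (Inr n) * r \<in> ?I"
    proof (induction rule: ideal_gen_induct)
      case (step s b q)
      have "indet (Inr n) * b \<in> ?I"
        using step(1)
      proof (cases rule: mixed_gensE)
        case (var z)
        then consider "z \<in> W" | i where "z = Inl i" "i \<in> C" by blast
        then show ?thesis
        proof cases
          case 1
          then show ?thesis unfolding var by (intro ideal_gen_mult indet_in_mixed) simp
        next
          case 2
          \<comment> \<open>This sum equals x_i y_n.\<close>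
          have "edge_binomial i n + indet (Inl n) * indet (Inr i) \<in> ?I"
            using 2 C by (intro ideal_gen_add ideal_gen_mult_right edge_binomial_in_mixed indet_in_mixed)
              (auto intro: clique_relI)
          then show ?thesis by (simp add: var 2 edge_binomial_def mult.commute)
        qed
      next
        case (edge i j)
        then show ?thesis using sub by (auto intro!: ideal_gen_mult edge_binomial_in_mixed)
      qed
      then have "s * (indet (Inr n) * b) + indet (Inr n) * q \<in> ?I"
        using step(3) by (intro ideal_gen_add) (auto intro: ideal_gen_mult)
      then show ?case by (simp add: algebra_simps)
    qed simp
    then show "p \<in> ?I" using \<open>q \<in> ?I\<close> by (simp add: pq ideal_gen_add)
  qed
qed

text \<open>Induction on the number of covered vertices, through the decomposition modulo x_n. The
  sum of the two ideals involves only the cliques other than \<open>C\<close>, which gives the bound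
  \<open>card A - 1\<close> required there; x_n is then removed as a nonzerodivisor.\<close>

lemma koszul_regular_cliques:
  assumes "admissible W A"
  shows "koszul_regular (int (card A)) (mixed_ideal W (clique_rel A) :: ('v::finite + 'v, 'k::field) mpoly set)"
  using assms
proof (induction "card (\<Union>A)" arbitrary: W A rule: less_induct)
  case less
  show ?case
  proof (cases "\<Union>A = {}")
    case True
    then have "clique_rel A = {}" by (auto simp: clique_rel_def)
    then show ?thesis by (simp add: koszul_regular_mono[OF koszul_regular_variables])
  next
    case False
    then obtain C n where C: "C \<in> A" "n \<in> C" by blast
    let ?A0 = "A - {C}" and ?A1 = "insert (C - {n}) (A - {C})"
    let ?W1 = "insert (Inr n) (insert (Inl n) W)" and ?W2 = "W \<union> Inl ` C"
    have disj: "n \<notin> C'" if "C' \<in> ?A0" for C'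
      using less.prems C that by (auto simp: admissible_def pairwise_def disjnt_iff)
    have vars: "Inl i \<notin> W" "Inr i \<notin> W" if "C' \<in> A" "i \<in> C'" for C' i
      using less.prems that by (auto simp: admissible_def)
    have disj': "disjnt C C'" if "C' \<in> ?A0" for C'
      using less.prems C that by (auto simp: admissible_def pairwise_def)
    have pw0: "pairwise disjnt ?A0"
      using less.prems by (auto simp: admissible_def intro: pairwise_subset)
    have pw1: "pairwise disjnt ?A1"
      unfolding pairwise_insert using pw0 disj' by (meson Diff_subset disjnt_subset1 disjnt_sym)
    have "i \<noteq> n" if "C' \<in> ?A1" "i \<in> C'" for C' i
      using that disj by blast
    then have adm1: "admissible ?W1 ?A1"
      using pw1 vars C unfolding admissible_def by (auto simp: Ball_def)
    have "i \<notin> C" if "C' \<in> ?A0" "i \<in> C'" for C' i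
      using disj'[OF that(1)] that(2) by (auto simp: disjnt_iff)
    then have "admissible ?W2 ?A0" "admissible (insert (Inr n) ?W2) ?A0"
      using pw0 vars disj unfolding admissible_def by (auto simp: Ball_def; blast)+
    note adm = adm1 this
    have less1: "card (\<Union>?A1) < card (\<Union>A)" "card (\<Union>?A0) < card (\<Union>A)"
      using C disj by (auto intro!: psubset_card_mono)
    have pos: "0 < card A" using C by (auto simp: card_gt_0_iff)
    have card0: "card ?A0 = card A - 1" using C by (simp add: card_Diff_singleton)
    \<comment> \<open>Only an inequality: \<open>C - {n}\<close> may be empty, and the empty set may
      already belong to \<open>A\<close>.\<close>
    then have card1: "card ?A1 \<le> card A"
      using card_insert_le_m1[OF pos, of ?A0 "C - {n}"] by simp
    have "koszul_regular (int (card A)) (mixed_ideal ?W1 (clique_rel ?A1) :: ('v + 'v, 'k) mpoly set)"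
      using koszul_regular_mono[OF less.hyps[OF less1(1) adm(1)]] card1 by simp
    moreover have "koszul_regular (int (card A)) (mixed_ideal ?W2 (clique_rel ?A0) :: ('v + 'v, 'k) mpoly set)"
      using koszul_regular_mono[OF less.hyps[OF less1(2) adm(2)]] card0 by simp
    \<comment> \<open>Modulo the x_i with i in \<open>C\<close> all binomials inside
      \<open>C\<close> vanish, so in the sum this clique leaves only variables.\<close>
    moreover have eq: "(ideal_gen (mixed_gens ?W1 (clique_rel ?A1) \<union> mixed_gens ?W2 (clique_rel ?A0)) ::
        ('v + 'v, 'k) mpoly set) = mixed_ideal (insert (Inr n) ?W2) (clique_rel ?A0)"
    proof
      show "ideal_gen (mixed_gens ?W1 (clique_rel ?A1) \<union> mixed_gens ?W2 (clique_rel ?A0)) \<subseteq>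
          (mixed_ideal (insert (Inr n) ?W2) (clique_rel ?A0) :: ('v + 'v, 'k) mpoly set)"
        unfolding mixed_gens_Un
      proof (rule mixed_ideal_subsetI)
        fix i j assume "(i, j) \<in> clique_rel ?A1 \<union> clique_rel ?A0"
        then consider "(i, j) \<in> clique_rel ?A0" | "i \<in> C" "j \<in> C" by (auto simp: clique_rel_def)
        then show "edge_binomial i j \<in> mixed_ideal (insert (Inr n) ?W2) (clique_rel ?A0)"
          by cases (intro edge_binomial_in_mixedI, auto)+
      qed (use C in \<open>auto intro!: indet_in_mixed\<close>)
      show "mixed_ideal (insert (Inr n) ?W2) (clique_rel ?A0) \<subseteq>
          (ideal_gen (mixed_gens ?W1 (clique_rel ?A1) \<union> mixed_gens ?W2 (clique_rel ?A0)) :: ('v + 'v, 'k) mpoly set)"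
        unfolding mixed_gens_Un by (rule mixed_ideal_mono) auto
    qed
    have "koszul_regular (int (card A) - 1)
        (ideal_gen (mixed_gens ?W1 (clique_rel ?A1) \<union> mixed_gens ?W2 (clique_rel ?A0)) :: ('v + 'v, 'k) mpoly set)"
      unfolding eq using less.hyps[OF less1(2) adm(3)] card0 pos by (simp add: of_nat_diff)
    ultimately have "koszul_regular (int (card A))
        (mixed_ideal ?W1 (clique_rel ?A1) \<inter> mixed_ideal ?W2 (clique_rel ?A0) :: ('v + 'v, 'k) mpoly set)"
      by (intro koszul_regular_Int homogeneous_mixed)
    then have "koszul_regular (int (card A)) (mixed_ideal (insert (Inl n) W) (clique_rel A) :: ('v + 'v, 'k) mpoly set)"
      unfolding clique_ideal_decomposition[OF less.prems C] .
    then show ?thesis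
      unfolding mixed_gens_insert
    proof (rule koszul_regular_nonzerodivisor)
      fix p :: "('v + 'v, 'k) mpoly"
      assume "indet (Inl n) * p \<in> mixed_ideal W (clique_rel A)"
      then show "p \<in> mixed_ideal W (clique_rel A)"
        by (rule mixed_ideal_nonzerodivisor[OF less.prems vars(1)[OF C]])
    qed
  qed
qed

text \<open>The ring is fixed by the vertex type, so deleting a vertex means adding both of its
  variables to the ideal.\<close>

definition vertex_vars :: "'v set \<Rightarrow> ('v + 'v) set" where
  "vertex_vars D = Inl ` D \<union> Inr ` D"

lemma edge_binomial_vertex_vars: "i \<in> D \<or> j \<in> D \<Longrightarrow> edge_binomial i j \<in> mixed_ideal (vertex_vars D) E"
  by (rule edge_binomial_in_mixedI) (auto simp: vertex_vars_def)

text \<open>The Pluecker relation: \<open>x\<^sub>v f\<^sub>i\<^sub>j = x\<^sub>i f\<^sub>v\<^sub>j - x\<^sub>j f\<^sub>v\<^sub>i\<close>, and likewise for \<open>y\<^sub>v\<close>.\<close>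

lemma indet_mult_edge_binomial:
  assumes "edge_binomial v i \<in> ideal_gen B" "edge_binomial v j \<in> ideal_gen B" "z = Inl v \<or> z = Inr v"
  shows "indet z * edge_binomial i j \<in> ideal_gen B"
proof -
  have "indet (Inl i) * edge_binomial v j - indet (Inl j) * edge_binomial v i \<in> ideal_gen B"
    "indet (Inr i) * edge_binomial v j - indet (Inr j) * edge_binomial v i \<in> ideal_gen B"
    using assms by (auto intro!: ideal_gen_diff ideal_gen_mult)
  then show ?thesis using assms(3) by (auto simp: edge_binomial_def algebra_simps)
qed

text \<open>Let \<sigma> set x_v and y_v to zero. It maps the second ideal into \<open>?I\<close>
  and changes an element of the first only by an element of \<open>?I\<close>; an element p of both
  is (p - \<sigma> p) + \<sigma> p.\<close>

lemma ohtani_decomposition: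
  fixes v :: "'v"
  assumes N: "\<And>i. i \<in> N \<Longrightarrow> i = v \<or> (v, i) \<in> E"
  shows "mixed_ideal (vertex_vars D) (E \<union> N \<times> N) \<inter> mixed_ideal (vertex_vars (insert v D)) E =
    (mixed_ideal (vertex_vars D) E :: ('v + 'v, 'k::comm_ring_1) mpoly set)"
    (is "?I1 \<inter> ?I2 = ?I")
proof
  show "?I \<subseteq> ?I1 \<inter> ?I2"
    by (intro Int_greatest mixed_ideal_mono) (auto simp: vertex_vars_def)
  define \<sigma> :: "('v + 'v, 'k) mpoly \<Rightarrow> ('v + 'v, 'k) mpoly" where
    "\<sigma> = restrict_keys (\<lambda>t. lookup t (Inl v) = 0 \<and> lookup t (Inr v) = 0)"
  have mult: "\<sigma> (p * q) = \<sigma> p * \<sigma> q" for p q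
    unfolding \<sigma>_def by (rule restrict_keys_mult) (auto simp: lookup_add)
  have indet: "\<sigma> (indet z) = (if z = Inl v \<or> z = Inr v then 0 else indet z)" for z
    by (auto simp: \<sigma>_def indet_def restrict_keys_single lookup_single when_def)
  have edge: "\<sigma> (edge_binomial i j) = (if i = v \<or> j = v then 0 else edge_binomial i j)" for i j
    unfolding edge_binomial_def
    by (auto simp: \<sigma>_def restrict_keys_diff) (auto simp: mult indet simp flip: \<sigma>_def)
  have add: "\<sigma> (p + q) = \<sigma> p + \<sigma> q" for p q
    by (simp add: \<sigma>_def restrict_keys_add)
  have in_I: "\<sigma> p \<in> ?I" if "p \<in> ?I2" for p
    using that
  proof (induction rule: ideal_gen_induct)
    case (step r b q)
    have "\<sigma> b \<in> ?I"
      using step(1)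
      by (cases rule: mixed_gensE)
        (auto simp: indet edge vertex_vars_def intro!: indet_in_mixed edge_binomial_in_mixed)
    then show ?case using step by (simp add: add mult ideal_gen_add ideal_gen_mult)
  qed (simp add: \<sigma>_def)
  have edge_v: "edge_binomial v i \<in> ?I" if "i \<in> N" for i
    using N[OF that] by (auto simp: edge_binomial_refl intro: edge_binomial_in_mixed)
  have edge_v': "edge_binomial i v \<in> ?I" if "i \<in> N" for i
    using ideal_gen_uminus[OF edge_v[OF that]] by (simp add: edge_binomial_swap[of i v])
  \<comment> \<open>Every monomial removed by \<sigma> contains x_v or y_v, and by the Pluecker
    relation such a variable times f_ij is a combination of f_vi and f_vj.\<close>
  have rest: "(r - \<sigma> r) * edge_binomial i j \<in> ?I" if "i \<in> N" "j \<in> N" for r i j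
  proof (induction r rule: poly_mapping_single_induct)
    case (single t a q)
    have "(single t a - \<sigma> (single t a)) * edge_binomial i j \<in> ?I"
    proof (cases "lookup t (Inl v) = 0 \<and> lookup t (Inr v) = 0")
      case False
      then obtain z where z: "z = Inl v \<or> z = Inr v" "lookup t z > 0" by auto
      have "single (t - single z 1) a * (indet z * edge_binomial i j) \<in> ?I"
        using z(1) by (intro ideal_gen_mult indet_mult_edge_binomial[of v] edge_v that)
      then have "single t a * edge_binomial i j \<in> ?I"
        unfolding single_eq_indet_mult[OF z(2)] by (simp only: ac_simps)
      then show ?thesis using False by (simp add: \<sigma>_def restrict_keys_single)
    qed (simp add: \<sigma>_def restrict_keys_single)
    from ideal_gen_add[OF this single] show ?case by (simp add: add algebra_simps)
  qed (simp add: \<sigma>_def)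
  have diff: "p - \<sigma> p \<in> ?I" if "p \<in> ?I1" for p
    using that
  proof (induction rule: ideal_gen_induct)
    case (step r b q)
    have "r * b - \<sigma> r * \<sigma> b \<in> ?I"
    proof (cases "b \<in> ?I \<and> \<sigma> b \<in> ?I")
      case True
      then show ?thesis by (simp add: ideal_gen_diff ideal_gen_mult)
    next
      case False
      \<comment> \<open>What remains are the new edges of the completed neighbourhood that avoid
        \<open>v\<close>; \<sigma> fixes their binomials.\<close>
      obtain i j where b: "b = edge_binomial i j" "(i, j) \<in> E \<or> i \<in> N \<and> j \<in> N"
        using step(1)
      proof (cases rule: mixed_gensE)
        case (var z)
        then show ?thesis using False by (auto simp: indet indet_in_mixed split: if_splits)
      qed (use that in auto)
      then have ij: "i \<in> N" "j \<in> N"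
        using False by (auto simp: edge edge_binomial_in_mixed split: if_splits)
      have "i \<noteq> v \<and> j \<noteq> v"
        using False edge_v[OF ij(2)] edge_v'[OF ij(1)] by (auto simp: b edge)
      then show ?thesis using rest[OF ij, of r] by (simp add: b edge left_diff_distrib)
    qed
    from ideal_gen_add[OF this step(3)] show ?case by (simp add: add mult algebra_simps)
  qed (simp add: \<sigma>_def)
  show "?I1 \<inter> ?I2 \<subseteq> ?I"
  proof
    fix p assume "p \<in> ?I1 \<inter> ?I2"
    then have "(p - \<sigma> p) + \<sigma> p \<in> ?I" by (intro ideal_gen_add diff in_I) auto
    then show "p \<in> ?I" by simp
  qed
qed

text \<open>A clique costs 1, a star centre 2, and \<open>D\<close> collects the deleted vertices.
  In Ohtani's decomposition, completing a neighbourhood lowers the cost, while deleting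
  \<open>v\<close> keeps it and enlarges \<open>D\<close>; so the measure drops for all three
  ideals.\<close>

lemma koszul_regular_cover:
  assumes "sym E" and "\<And>C. C \<in> A \<Longrightarrow> C \<times> C \<subseteq> E"
    and "\<And>i j. (i, j) \<in> E \<Longrightarrow> (\<exists>C\<in>A. i \<in> C \<and> j \<in> C) \<or> i \<in> S \<or> j \<in> S"
  shows "koszul_regular (int (card A + 2 * card S))
    (mixed_ideal (vertex_vars D) E :: ('v::finite + 'v, 'k::field) mpoly set)"
  using assms
proof (induction "card A + 2 * card S + card (- D)" arbitrary: A S D E rule: less_induct)
  case less
  show ?case
  proof (cases "\<exists>v. v \<notin> D \<and> (v \<in> S \<or> (\<exists>C\<in>A. \<exists>C'\<in>A. C \<noteq> C' \<and> v \<in> C \<and> v \<in> C'))")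
    case True
    then obtain v where v: "v \<notin> D" "v \<in> S \<or> (\<exists>C\<in>A. \<exists>C'\<in>A. C \<noteq> C' \<and> v \<in> C \<and> v \<in> C')"
      by blast
    define N where "N = insert v (E `` {v})"
    have N: "i = v \<or> (v, i) \<in> E" if "i \<in> N" for i using that by (auto simp: N_def)
    define E' where "E' = E \<union> N \<times> N"
    \<comment> \<open>\<open>N\<close> replaces all cliques through \<open>v\<close> and covers
      every edge at \<open>v\<close>, so \<open>v\<close> is no longer needed as a centre.\<close>
    define A' where "A' = insert N {C \<in> A. v \<notin> C}"
    define S' where "S' = S - {v}"
    let ?k = "card A + 2 * card S" and ?k' = "card A' + 2 * card S'"
    \<comment> \<open>Either a centre of cost 2 is traded for one clique, or at least two cliques
      are traded for one.\<close>
    have k: "?k' < ?k"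
    proof (cases "v \<in> S")
      case True
      have "card A' \<le> Suc (card {C \<in> A. v \<notin> C})"
        unfolding A'_def by (rule card_insert_le_m1[of "Suc _", simplified]) simp
      also have "card {C \<in> A. v \<notin> C} \<le> card A" by (intro card_mono) auto
      finally have "card A' \<le> Suc (card A)" by simp
      moreover have "Suc (card S') = card S" using True unfolding S'_def by (intro card_Suc_Diff1) simp_all
      ultimately show ?thesis by simp
    next
      case False
      then obtain C C' where C: "C \<in> A" "C' \<in> A" "C \<noteq> C'" "v \<in> C" "v \<in> C'" using v by blast
      have "card A' \<le> Suc (card {C \<in> A. v \<notin> C})"
        unfolding A'_def by (rule card_insert_le_m1[of "Suc _", simplified]) simp
      also have "card {C \<in> A. v \<notin> C} \<le> card (A - {C, C'})"
        using C by (intro card_mono) auto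
      also have "card (A - {C, C'}) = card A - 2"
        using C by (subst card_Diff_subset) auto
      finally have "card A' \<le> Suc (card A - 2)" by simp
      moreover have "2 \<le> card A"
        using card_mono[of A "{C, C'}"] C by simp
      moreover have "card S' = card S" using False by (simp add: S'_def)
      ultimately show ?thesis by simp
    qed
    have sym': "sym E'" using less.prems(1) by (auto simp: E'_def sym_def)
    have clique': "C \<times> C \<subseteq> E'" if "C \<in> A'" for C
      using less.prems(2) that by (auto simp: A'_def E'_def)
    have cover': "(\<exists>C\<in>A'. i \<in> C \<and> j \<in> C) \<or> i \<in> S' \<or> j \<in> S'" if "(i, j) \<in> E'" for i j
    proof (cases "i \<in> N \<and> j \<in> N")
      case True
      then show ?thesis by (auto simp: A'_def)
    next
      case False
      then have ij: "(i, j) \<in> E" using that by (auto simp: E'_def)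
      moreover from this have "(j, i) \<in> E" using less.prems(1) by (auto simp: sym_def)
      ultimately have "i \<noteq> v" "j \<noteq> v" using False by (auto simp: N_def)
      moreover have "v \<notin> C" if "C \<in> A" "i \<in> C" "j \<in> C" for C
        using less.prems(2)[OF that(1)] that False by (auto simp: N_def)
      ultimately show ?thesis
        using less.prems(3)[OF ij] by (auto simp: A'_def S'_def)
    qed
    have D: "card (- insert v D) < card (- D)" using v(1) by (intro psubset_card_mono) auto
    have IH': "koszul_regular (int ?k') (mixed_ideal (vertex_vars D') E' :: ('v + 'v, 'k) mpoly set)"
      if "card (- D') \<le> card (- D)" for D'
      using less.hyps[of A' S' D' E', OF _ sym' clique' cover'] k that by simp
    have reg1: "koszul_regular (int ?k) (mixed_ideal (vertex_vars D) E' :: ('v + 'v, 'k) mpoly set)"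
      by (rule koszul_regular_mono[OF IH']) (use k in auto)
    have reg2: "koszul_regular (int ?k) (mixed_ideal (vertex_vars (insert v D)) E :: ('v + 'v, 'k) mpoly set)"
      using less.hyps[of A S "insert v D" E] D less.prems by simp
    \<comment> \<open>The strict drop of the cost supplies the \<open>- 1\<close> that the
      intersection requires of the sum.\<close>
    have reg3: "koszul_regular (int ?k - 1) (mixed_ideal (vertex_vars (insert v D)) E' :: ('v + 'v, 'k) mpoly set)"
      by (rule koszul_regular_mono[OF IH']) (use k D in auto)
    have "koszul_regular (int ?k - 1)
        (ideal_gen (mixed_gens (vertex_vars D) E' \<union> mixed_gens (vertex_vars (insert v D)) E) :: ('v + 'v, 'k) mpoly set)"
    proof -
      have "vertex_vars D \<union> vertex_vars (insert v D) = vertex_vars (insert v D)" "E' \<union> E = E'"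
        by (auto simp: vertex_vars_def E'_def)
      then show ?thesis unfolding mixed_gens_Un using reg3 by simp
    qed
    with reg1 reg2 have "koszul_regular (int ?k)
        (mixed_ideal (vertex_vars D) E' \<inter> mixed_ideal (vertex_vars (insert v D)) E :: ('v + 'v, 'k) mpoly set)"
      by (intro koszul_regular_Int homogeneous_mixed)
    moreover have "mixed_ideal (vertex_vars D) E' \<inter> mixed_ideal (vertex_vars (insert v D)) E =
        (mixed_ideal (vertex_vars D) E :: ('v + 'v, 'k) mpoly set)"
      unfolding E'_def by (rule ohtani_decomposition) (rule N)
    ultimately show ?thesis by simp
  next
    case False
    \<comment> \<open>No vertex outside \<open>D\<close> is a centre or lies in two cliques: away
      from \<open>D\<close> the cliques are disjoint and contain all edges.\<close>
    define A' where "A' = (\<lambda>C. C - D) ` A"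
    have "pairwise disjnt A'"
    proof (rule pairwiseI)
      fix X Y assume "X \<in> A'" "Y \<in> A'" "X \<noteq> Y"
      then obtain C C' where "C \<in> A" "C' \<in> A" "C \<noteq> C'" "X = C - D" "Y = C' - D"
        by (auto simp: A'_def)
      then show "disjnt X Y" using False unfolding disjnt_iff by blast
    qed
    then have "admissible (vertex_vars D) A'"
      by (auto simp: admissible_def A'_def vertex_vars_def)
    then have "koszul_regular (int (card A')) (mixed_ideal (vertex_vars D) (clique_rel A') :: ('v + 'v, 'k) mpoly set)"
      by (rule koszul_regular_cliques)
    moreover have "card A' \<le> card A" unfolding A'_def by (rule card_image_le) simp
    moreover have "mixed_ideal (vertex_vars D) (clique_rel A') = (mixed_ideal (vertex_vars D) E :: ('v + 'v, 'k) mpoly set)"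
    proof
      show "mixed_ideal (vertex_vars D) (clique_rel A') \<subseteq> (mixed_ideal (vertex_vars D) E :: ('v + 'v, 'k) mpoly set)"
        using less.prems(2) by (intro mixed_ideal_mono) (auto simp: clique_rel_def A'_def)
      show "mixed_ideal (vertex_vars D) E \<subseteq> (mixed_ideal (vertex_vars D) (clique_rel A') :: ('v + 'v, 'k) mpoly set)"
      proof (rule mixed_ideal_subsetI)
        fix i j assume ij: "(i, j) \<in> E"
        show "edge_binomial i j \<in> mixed_ideal (vertex_vars D) (clique_rel A')"
        proof (cases "i \<in> D \<or> j \<in> D")
          case True
          then show ?thesis by (rule edge_binomial_vertex_vars)
        next
          case False': False
          then obtain C where "C \<in> A" "i \<in> C" "j \<in> C"
            using less.prems(3)[OF ij] False by blast
          then show ?thesis using False'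
            by (intro edge_binomial_in_mixed clique_relI[of "C - D"]) (auto simp: A'_def)
        qed
      qed (rule indet_in_mixed)
    qed
    ultimately show ?thesis
      by (simp add: koszul_regular_mono[of "int (card A')"])
  qed
qed

section \<open>From Koszul homology to minimal resolutions\<close>

lemma homogeneous_ideal_zero: "homogeneous_ideal ({0} :: ('x::finite, 'k::field) mpoly set)"
proof -
  have "ideal_gen {} = ({0} :: ('x, 'k) mpoly set)"
    unfolding ideal_gen_def by (rule Modules.module.span_empty[OF module_mult])
  then show ?thesis unfolding homogeneous_ideal_def by (intro exI[of _ "{}"]) simp
qed

lemma homogeneous_contract:
  fixes c :: "'x::finite set \<Rightarrow> ('x, 'k::field) mpoly"
  assumes "\<And>S. c S \<in> homogeneous d"
  shows "contract x c S \<in> homogeneous d"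
  using assms[of "insert x S"] homogeneous_diff[OF homogeneous_zero assms, of "insert x S"]
    koszul_sign_cases[of x S, where ?'r = "('x, 'k) mpoly"]
  by (auto simp: contract_def)

text \<open>The Koszul complex of R is exact except for the constants at \<open>S = {}\<close>,
  which \<open>irr\<close> excludes. Positive coefficient degree is covered by \<open>reg0\<close>,
  with the filling cut down to one exterior degree; otherwise \<open>c\<close> itself is
  zero.\<close>

lemma koszul_acyclic:
  fixes c :: "'x::finite set \<Rightarrow> ('x, 'k::field) mpoly"
  assumes reg0: "koszul_regular 0 ({0} :: ('x, 'k) mpoly set)"
    and hom: "\<And>S. c S \<in> homogeneous \<delta>" and supp: "\<And>S. card S \<noteq> p \<Longrightarrow> c S = 0"
    and cyc: "\<And>S. koszul_bd c S = 0" and irr: "lookup (c {}) 0 = 0"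
  obtains e where "\<And>S. e S \<in> homogeneous (\<delta> - 1)" "\<And>S. card S \<noteq> Suc p \<Longrightarrow> e S = 0"
    "\<And>S. koszul_bd e S = c S"
proof (cases "0 < \<delta>")
  case True
  obtain e where e: "\<And>S. e S \<in> homogeneous (\<delta> - 1)" "\<And>S. c S - koszul_bd e S \<in> {0}"
    by (rule koszul_regular_homogeneousE[OF reg0 homogeneous_ideal_zero True, of c])
      (use hom cyc in auto)
  show ?thesis
  proof (rule that[of "\<lambda>S. if card S = Suc p then e S else 0"])
    show "koszul_bd (\<lambda>S. if card S = Suc p then e S else 0) S = c S" for S
      using e(2)[of S] supp[of S] by (simp add: koszul_bd_restrict_card)
  qed (use e in auto)
next
  case False
  have "c S = 0" for S
  proof (cases "\<delta> = 0")
    case True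
    show ?thesis
    proof (cases "S = {}")
      case True
      then show ?thesis using homogeneous_zero_degree[of "c {}"] hom[of "{}"] irr \<open>\<delta> = 0\<close> by simp
    next
      case False
      then obtain x where x: "x \<in> S" by blast
      define T where "T = S - {x}"
      have contract: "contract y c T = single 0 (lookup (contract y c T) 0)" for y
        using homogeneous_contract[of c 0 y T] hom True by (intro homogeneous_zero_degree) simp
      \<comment> \<open>With constant coefficients the boundary is a linear form whose coefficient
        at \<open>x\<close> is \<open>contract x c T\<close>, that is, \<open>c S\<close> up to
        sign.\<close>
      have "koszul_bd c T = (\<Sum>y\<in>UNIV. single (single y 1) (lookup (contract y c T) 0))"
        unfolding koszul_bd_def
        by (intro sum.cong refl, subst contract) (simp add: indet_def mult_single)
      moreover have "single y (1::nat) = single x 1 \<longleftrightarrow> y = x" for y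
        by (metis lookup_single_eq lookup_single_not_eq one_neq_zero)
      ultimately have "lookup (koszul_bd c T) (single x 1) =
          (\<Sum>y\<in>UNIV. if y = x then lookup (contract y c T) 0 else 0)"
        by (simp only: lookup_sum lookup_single when_def)
      then have "lookup (contract x c T) 0 = 0" by (simp add: cyc)
      then have "contract x c T = 0" using contract[of x] by simp
      moreover have "insert x T = S" "x \<notin> T" using x by (auto simp: T_def)
      ultimately have "koszul_sign x T * c S = 0" by (simp add: contract_def)
      then have "koszul_sign x T * (koszul_sign x T * c S) = 0" by simp
      then show ?thesis by (simp add: koszul_sign_square)
    qed
  next
    case neq: False
    then show ?thesis using homogeneous_neg[OF _ hom] False by simp
  qed
  then show ?thesis by (intro that[of "\<lambda>S. 0"]) (simp_all add: koszul_bd_zero)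
qed

lemma lookup_koszul_bd_zero:
  fixes c :: "'x::finite set \<Rightarrow> ('x, 'k::field) mpoly"
  shows "lookup (koszul_bd c S) 0 = 0"
proof -
  have "lookup (indet x) 0 = (0 :: 'k)" for x :: 'x
    by (auto simp: indet_def lookup_single when_def poly_mapping_eq_iff fun_eq_iff)
  then show ?thesis by (simp add: koszul_bd_def lookup_sum lookup_mult_zero)
qed

lemma mult_mat_vec_index:
  assumes "M \<in> carrier_mat m n" "l < m"
  shows "(M *\<^sub>v vec n f) $ l = (\<Sum>k<n. M $$ (l, k) * f k)"
  using assms by (auto simp: scalar_prod_def atLeast0LessThan intro!: sum.cong)

text \<open>The double complex of the Koszul complex and the resolution is chased in the coefficients of
  the basis vectors, so that vectors become functions on indices.\<close>

lemma degree_le_of_koszul_regular: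
  fixes B :: "('x::finite, 'k::field) mpoly set"
  assumes reg0: "koszul_regular 0 ({0} :: ('x, 'k) mpoly set)"
    and reg: "koszul_regular r (ideal_gen B)"
    and res: "minimal_graded_free_resolution (*) homogeneous (ideal_gen B) b d \<phi> g"
    and k: "k < b i"
  shows "d i k \<le> int i + r"
proof (rule ccontr)
  let ?I = "ideal_gen B"
  note min = res[unfolded minimal_graded_free_resolution_def graded_free_resolution_def]
  note grad = min[THEN conjunct1]
  note \<phi> = grad[THEN conjunct1, rule_format]
  note \<phi>_hom = grad[THEN conjunct2, THEN conjunct1, rule_format]
  note g = grad[THEN conjunct2, THEN conjunct2, THEN conjunct1, rule_format]
  note surj = grad[THEN conjunct2, THEN conjunct2, THEN conjunct2, THEN conjunct1, rule_format]
  note exact0 = grad[THEN conjunct2, THEN conjunct2, THEN conjunct2, THEN conjunct2, THEN conjunct1]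
  note exact = grad[THEN conjunct2, THEN conjunct2, THEN conjunct2, THEN conjunct2, THEN conjunct2, rule_format]
  note \<phi>_irr = min[THEN conjunct2, rule_format]
  define aug where "aug f = (\<Sum>k<b 0. f k * g k)" for f
  define act where "act n f l = (\<Sum>k<b (Suc n). \<phi> n $$ (l, k) * f k)" for n f l
  have aug_vec: "augmentation (*) (b 0) g (vec (b 0) f) = aug f" for f
    by (simp add: augmentation_def aug_def)
  have act_vec: "\<phi> n *\<^sub>v vec (b (Suc n)) f = vec (b n) (act n f)" for n f
    using \<phi>[of n] by (intro eq_vecI) (auto simp: mult_mat_vec_index[OF \<phi>] act_def simp del: index_mult_mat_vec)
  have vec_cong: "vec m f = vec m h \<longleftrightarrow> (\<forall>l<m. f l = h l)" for m and f h :: "nat \<Rightarrow> ('x, 'k) mpoly"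
    by (auto simp: vec_eq_iff)
  have vec_expand: "\<exists>f. v = vec m f" if "v \<in> carrier_vec m" for m and v :: "('x, 'k) mpoly vec"
    using that by (intro exI[of _ "\<lambda>k. v $ k"]) auto
  have aug_surj: "\<exists>f. m - aug f \<in> ?I" for m
    using surj[of m] vec_expand aug_vec by metis
  have aug_act: "aug (act 0 f) \<in> ?I" for f
  proof -
    have "\<phi> 0 *\<^sub>v vec (b 1) f \<in> {v \<in> carrier_vec (b 0). augmentation (*) (b 0) g v \<in> ?I}"
      unfolding exact0[symmetric] by auto
    then show ?thesis using act_vec[of 0 f] aug_vec by simp
  qed
  have aug_exact: "\<exists>w. \<forall>l<b 0. f l = act 0 w l" if "aug f \<in> ?I" for f
  proof -
    have "vec (b 0) f \<in> {\<phi> 0 *\<^sub>v w | w. w \<in> carrier_vec (b 1)}"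
      unfolding exact0 using that by (simp add: aug_vec)
    then obtain w where "w \<in> carrier_vec (b 1)" "vec (b 0) f = \<phi> 0 *\<^sub>v w" by blast
    then show ?thesis using vec_expand[of w "b 1"] act_vec[of 0] vec_cong by auto
  qed
  have act_act: "act n (act (Suc n) f) l = 0" if "l < b n" for n f l
  proof -
    have "\<phi> (Suc n) *\<^sub>v vec (b (Suc (Suc n))) f \<in> {v \<in> carrier_vec (b (Suc n)). \<phi> n *\<^sub>v v = 0\<^sub>v (b n)}"
      unfolding exact[symmetric] by auto
    then have "vec (b n) (act n (act (Suc n) f)) = 0\<^sub>v (b n)" by (simp add: act_vec)
    then show ?thesis using that by (metis index_vec index_zero_vec(1))
  qed
  have act_exact: "\<exists>w. \<forall>l<b (Suc n). f l = act (Suc n) w l" if "\<And>l. l < b n \<Longrightarrow> act n f l = 0" for n f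
  proof -
    have "vec (b (Suc n)) f \<in> {\<phi> (Suc n) *\<^sub>v w | w. w \<in> carrier_vec (b (Suc (Suc n)))}"
      unfolding exact using that by (auto simp: act_vec intro!: eq_vecI)
    then obtain w where "w \<in> carrier_vec (b (Suc (Suc n)))" "vec (b (Suc n)) f = \<phi> (Suc n) *\<^sub>v w" by blast
    then show ?thesis using vec_expand[of w "b (Suc (Suc n))"] act_vec[of "Suc n"] vec_cong by auto
  qed
  have act_cong: "act n f l = act n h l" if "\<And>k. k < b (Suc n) \<Longrightarrow> f k = h k" for n f h l
    unfolding act_def using that by (intro sum.cong) auto
  have act_diff: "act n (\<lambda>k. f k - h k) l = act n f l - act n h l" for n f h l
    by (simp add: act_def right_diff_distrib sum_subtractf)
  have aug_diff: "aug (\<lambda>k. f k - h k) = aug f - aug h" for f h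
    by (simp add: aug_def left_diff_distrib sum_subtractf)
  have bd_act: "koszul_bd (\<lambda>S. act n (\<lambda>k. c k S) l) S = act n (\<lambda>k. koszul_bd (c k) S) l" for n c l S
    by (simp add: act_def koszul_bd_sum koszul_bd_lin)
  have bd_aug: "koszul_bd (\<lambda>S. aug (\<lambda>k. c k S)) S = aug (\<lambda>k. koszul_bd (c k) S)" for c S
    by (simp add: aug_def koszul_bd_sum koszul_bd_mult_right)
  have lookup_act: "lookup (act n f l) 0 = 0" if "l < b n" for n f l
    unfolding act_def lookup_sum lookup_mult_zero
    using lookup_irrelevant_ideal[OF \<phi>_irr[OF that]] by (intro sum.neutral) simp

  \<comment> \<open>\<open>c\<close> is a chain of exterior degree \<open>p\<close> with
    coefficients in F_n and internal degree \<open>j\<close>, and its Koszul boundary dies under the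
    next map towards R/I. Each recursive step lowers \<open>n\<close> and raises \<open>p\<close> by
    one, so the bound on \<open>r\<close> persists down to \<open>n = 0\<close>.\<close>
  have chase: "\<exists>w w'. \<forall>l<b n. \<forall>S. c l S = koszul_bd (w l) S + act n (\<lambda>k. w' k S) l"
    if "r < j - int p - int n"
      and "\<And>l S. l < b n \<Longrightarrow> c l S \<in> homogeneous (j - int p - d n l)"
      and "\<And>l S. l < b n \<Longrightarrow> card S \<noteq> p \<Longrightarrow> c l S = 0"
      and "\<And>S. n = 0 \<Longrightarrow> aug (\<lambda>k. koszul_bd (c k) S) \<in> ?I"
      and "\<And>m S l. n = Suc m \<Longrightarrow> l < b m \<Longrightarrow> act m (\<lambda>k. koszul_bd (c k) S) l = 0"
    for n p j and c :: "nat \<Rightarrow> 'x set \<Rightarrow> ('x, 'k) mpoly"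
    using that
  proof (induction n arbitrary: p c)
    case 0
    have "aug (\<lambda>k. c k S) \<in> homogeneous (j - int p)" for S
      unfolding aug_def using homogeneous_mult[OF 0(2) g] by (intro homogeneous_sum) fastforce
    moreover have "koszul_bd (\<lambda>S. aug (\<lambda>k. c k S)) S \<in> ?I" for S
      using 0(4) by (simp add: bd_aug)
    \<comment> \<open>Pushed into R/I the chain is a cycle of coefficient degree above
      \<open>r\<close>, hence has a filling; lifting the filling through the augmentation leaves an
      error in the image of \<open>act 0\<close>.\<close>
    ultimately obtain u where u: "\<And>S. aug (\<lambda>k. c k S) - koszul_bd u S \<in> ?I"
      using reg[unfolded koszul_regular_def, rule_format, of "j - int p" "\<lambda>S. aug (\<lambda>k. c k S)"] 0(1)
      by auto
    have "\<forall>S. \<exists>f. u S - aug f \<in> ?I" using aug_surj by blast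
    from choice[OF this] obtain w0 where w0: "\<forall>S. u S - aug (w0 S) \<in> ?I" ..
    define w where "w k S = w0 S k" for k S
    have "koszul_bd (\<lambda>S. u S - aug (\<lambda>k. w k S)) S \<in> ?I" for S
      using w0 by (intro koszul_bd_in_ideal) (simp add: w_def)
    then have "koszul_bd u S - aug (\<lambda>k. koszul_bd (w k) S) \<in> ?I" for S
      by (simp add: koszul_bd_lin bd_aug)
    from ideal_gen_add[OF u this, of S S for S] have "aug (\<lambda>k. c k S - koszul_bd (w k) S) \<in> ?I" for S
      by (simp add: aug_diff)
    then have "\<forall>S. \<exists>w'. \<forall>l<b 0. c l S - koszul_bd (w l) S = act 0 w' l"
      by (intro allI aug_exact)
    from choice[OF this] obtain w' where
      w': "\<forall>S. \<forall>l<b 0. c l S - koszul_bd (w l) S = act 0 (w' S) l" ..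
    have "\<forall>l<b 0. \<forall>S. c l S = koszul_bd (w l) S + act 0 (\<lambda>k. w' S k) l"
      using w' by (metis add_diff_cancel_left' diff_add_cancel add.commute)
    then show ?case by (rule exI[of _ w, OF exI[of _ "\<lambda>k S. w' S k"]])
  next
    case (Suc m)
    define f where "f l S = act m (\<lambda>k. c k S) l" for l S
    \<comment> \<open>The image of \<open>c\<close> in F_m is a Koszul cycle, without constant terms
      by minimality, so acyclicity of the Koszul complex lifts it to exterior degree
      \<open>Suc p\<close>.\<close>
    have "\<exists>e. (\<forall>S. e S \<in> homogeneous (j - int p - d m l - 1)) \<and> (\<forall>S. card S \<noteq> Suc p \<longrightarrow> e S = 0) \<and>
        (\<forall>S. koszul_bd e S = f l S)" if l: "l < b m" for l
    proof -
      have h1: "f l S \<in> homogeneous (j - int p - d m l)" for S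
        unfolding f_def act_def using homogeneous_mult[OF \<phi>_hom[OF l] Suc.prems(2)]
        by (intro homogeneous_sum) fastforce
      have h2: "f l S = 0" if "card S \<noteq> p" for S
        unfolding f_def act_def using Suc.prems(3) that by (intro sum.neutral) simp
      have h3: "koszul_bd (f l) S = 0" for S
        unfolding f_def bd_act using Suc.prems(5)[OF refl l] .
      have h4: "lookup (f l {}) 0 = 0" unfolding f_def by (rule lookup_act[OF l])
      obtain e where "\<And>S. e S \<in> homogeneous (j - int p - d m l - 1)"
          "\<And>S. card S \<noteq> Suc p \<Longrightarrow> e S = 0" "\<And>S. koszul_bd e S = f l S"
        by (rule koszul_acyclic[OF reg0, of "f l" "j - int p - d m l" p]) (use h1 h2 h3 h4 in auto)
      then show ?thesis by blast
    qed
    then obtain c' where c': "\<And>l S. l < b m \<Longrightarrow> c' l S \<in> homogeneous (j - int p - d m l - 1)"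
        "\<And>l S. l < b m \<Longrightarrow> card S \<noteq> Suc p \<Longrightarrow> c' l S = 0"
        "\<And>l S. l < b m \<Longrightarrow> koszul_bd (c' l) S = f l S"
      by metis
    have "\<exists>w w'. \<forall>l<b m. \<forall>S. c' l S = koszul_bd (w l) S + act m (\<lambda>k. w' k S) l"
    proof (rule Suc.IH[of "Suc p"])
      show "r < j - int (Suc p) - int m" using Suc.prems(1) by simp
      show "c' l S \<in> homogeneous (j - int (Suc p) - d m l)" if "l < b m" for l S
        using c'(1)[OF that, of S] by (simp add: algebra_simps)
      show "c' l S = 0" if "l < b m" "card S \<noteq> Suc p" for l S
        using c'(2) that by simp
      show "aug (\<lambda>k. koszul_bd (c' k) S) \<in> ?I" if "m = 0" for S
      proof -
        have "aug (\<lambda>k. koszul_bd (c' k) S) = aug (act 0 (\<lambda>k. c k S))"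
          unfolding aug_def using c'(3) that by (intro sum.cong) (auto simp: f_def)
        then show ?thesis by (simp add: aug_act)
      qed
      show "act q (\<lambda>k. koszul_bd (c' k) S) l = 0" if "m = Suc q" "l < b q" for q S l
      proof -
        have "act q (\<lambda>k. koszul_bd (c' k) S) l = act q (act (Suc q) (\<lambda>k. c k S)) l"
          using c'(3) that(1) by (intro act_cong) (simp add: f_def)
        then show ?thesis using act_act[OF that(2)] by simp
      qed
    qed
    then obtain w w' where w: "\<And>l S. l < b m \<Longrightarrow> c' l S = koszul_bd (w l) S + act m (\<lambda>k. w' k S) l"
      by blast
    \<comment> \<open>The image of \<open>c\<close> under \<open>act m\<close> is the boundary of
      \<open>c'\<close>, hence the image of the boundary of \<open>w'\<close>. Exactness therefore
      applies to the difference of \<open>c\<close> and that boundary.\<close>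
    have "\<forall>S. \<exists>w''. \<forall>k<b (Suc m). c k S - koszul_bd (w' k) S = act (Suc m) w'' k"
    proof (intro allI act_exact)
      fix S l assume l: "l < b m"
      have eq: "c' l = (\<lambda>S. koszul_bd (w l) S + act m (\<lambda>k. w' k S) l)"
        using w[OF l] by (rule ext)
      have "f l S = koszul_bd (c' l) S" using c'(3)[OF l] by simp
      also have "\<dots> = act m (\<lambda>k. koszul_bd (w' k) S) l"
        unfolding eq koszul_bd_lin(1) bd_act by (simp add: koszul_bd_bd)
      finally have "f l S = act m (\<lambda>k. koszul_bd (w' k) S) l" .
      then show "act m (\<lambda>k. c k S - koszul_bd (w' k) S) l = 0"
        by (simp add: act_diff f_def)
    qed
    from choice[OF this] obtain w'' where
      w'': "\<forall>S. \<forall>k<b (Suc m). c k S - koszul_bd (w' k) S = act (Suc m) (w'' S) k" ..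
    have "\<forall>k<b (Suc m). \<forall>S. c k S = koszul_bd (w' k) S + act (Suc m) (\<lambda>k. w'' S k) k"
    proof (intro allI impI)
      fix k S assume "k < b (Suc m)"
      then have "c k S - koszul_bd (w' k) S = act (Suc m) (w'' S) k" using w'' by blast
      then show "c k S = koszul_bd (w' k) S + act (Suc m) (\<lambda>k. w'' S k) k"
        by (metis add_diff_cancel_left' diff_add_cancel add.commute)
    qed
    then show ?case by (rule exI[of _ w', OF exI[of _ "\<lambda>k S. w'' S k"]])
  qed

  assume "\<not> d i k \<le> int i + r"
  \<comment> \<open>The basis vector e_k of F_i, as a chain of exterior degree 0 and internal degree
    \<open>d i k\<close>.\<close>
  define c :: "nat \<Rightarrow> 'x set \<Rightarrow> ('x, 'k) mpoly" where "c l S = (if l = k \<and> S = {} then 1 else 0)" for l S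
  have bd_c: "koszul_bd (c l) S = 0" for l S
    unfolding koszul_bd_def by (intro sum.neutral) (simp add: contract_def c_def)
  have one: "(1 :: ('x, 'k) mpoly) \<in> homogeneous 0"
    by (simp add: homogeneous_def monom_degree_def)
  have "\<exists>w w'. \<forall>l<b i. \<forall>S. c l S = koszul_bd (w l) S + act i (\<lambda>k. w' k S) l"
  proof (rule chase[where j = "d i k" and p = 0 and n = i and c = c])
    show "r < d i k - int 0 - int i" using \<open>\<not> d i k \<le> int i + r\<close> by simp
    show "c l S \<in> homogeneous (d i k - int 0 - d i l)" for l S
      by (simp add: c_def one)
    show "c l S = 0" if "card S \<noteq> 0" for l S
      using that by (auto simp: c_def)
    show "aug (\<lambda>k. koszul_bd (c k) S) \<in> ?I" for S
      by (simp add: bd_c aug_def)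
    show "act m (\<lambda>k. koszul_bd (c k) S) l = 0" for m S l
      by (simp add: bd_c act_def)
  qed
  then obtain w w' where "\<forall>l<b i. \<forall>S. c l S = koszul_bd (w l) S + act i (\<lambda>k. w' k S) l"
    by (elim exE)
  then have "c k {} = koszul_bd (w k) {} + act i (\<lambda>k. w' k {}) k"
    using k by (elim allE[of _ k] allE[of _ "{}"] impE)
  \<comment> \<open>Koszul boundaries and, by minimality, the images of the differentials have no
    constant term, whereas this coefficient is 1.\<close>
  then have "lookup (c k {}) 0 = 0" by (simp add: lookup_add lookup_koszul_bd_zero lookup_act k)
  then show False by (simp add: c_def)
qed

section \<open>Edge covers by cliques and stars\<close>

lemma complete_subgraph_edge:
  assumes "simple_graph H" "graph_isomorphic H (complete_graph m)" "i \<in> verts H" "j \<in> verts H" "i \<noteq> j"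
  shows "{i, j} \<in> edges H"
proof -
  obtain f where f: "bij_betw f (verts H) {1..m}"
      "(\<lambda>e. f ` e) ` edges H = {{i, j} | i j. i \<in> {1..m} \<and> j \<in> {1..m} \<and> i \<noteq> j}"
    using assms(2) by (auto simp: graph_isomorphic_def complete_graph_def)
  have "f i \<noteq> f j" "f i \<in> {1..m}" "f j \<in> {1..m}"
    using f(1) assms(3-5) by (auto simp: bij_betw_def inj_on_def)
  then have "{f i, f j} \<in> (\<lambda>e. f ` e) ` edges H" unfolding f(2) by blast
  then obtain e where e: "e \<in> edges H" "f ` {i, j} = f ` e" by auto
  moreover have "e \<subseteq> verts H" using assms(1) e(1) by (auto simp: simple_graph_def)
  ultimately have "{i, j} = e"
    using f(1) assms(3,4) by (subst (asm) inj_on_image_eq_iff[of f "verts H"]) (auto simp: bij_betw_def)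
  then show ?thesis using e by simp
qed

text \<open>The centre is the vertex sent to the label 1, which every edge of the model star
  contains.\<close>

lemma star_subgraph_centre:
  assumes "simple_graph H" "graph_isomorphic H (star_graph m)"
  shows "\<exists>v. \<forall>e\<in>edges H. v \<in> e"
proof -
  obtain f where f: "bij_betw f (verts H) {1..m + 1}" "(\<lambda>e. f ` e) ` edges H = {{1, i} | i. i \<in> {2..m + 1}}"
    using assms(2) by (auto simp: graph_isomorphic_def star_graph_def)
  have inj: "inj_on f (verts H)" and "f ` verts H = {1..m + 1}"
    using f(1) by (simp_all add: bij_betw_def)
  then have "1 \<in> f ` verts H" by simp
  then obtain v where v: "v \<in> verts H" "f v = 1" by auto
  have "v \<in> e" if "e \<in> edges H" for e
  proof -
    have "f ` e \<in> {{1, i} | i. i \<in> {2..m + 1}}" using that f(2) by blast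
    then have "1 \<in> f ` e" by auto
    then obtain u where "u \<in> e" "f u = 1" by auto
    moreover have "u \<in> verts H" using assms(1) that \<open>u \<in> e\<close> by (auto simp: simple_graph_def)
    ultimately have "u = v" using v by (intro inj_onD[OF inj]) simp_all
    then show ?thesis using \<open>u \<in> e\<close> by simp
  qed
  then show ?thesis by blast
qed

theorem theorem1p4:
  fixes G :: "'v::finite graph" and \<A> \<B> :: "'v graph set"
  assumes "simple_graph G" and "verts G = UNIV"
    and "\<forall>H\<in>\<A>. subgraph_of H G \<and> (\<exists>m\<ge>2. graph_isomorphic H (complete_graph m))"
    and "\<forall>H\<in>\<B>. subgraph_of H G \<and> (\<exists>m\<ge>2. graph_isomorphic H (star_graph m))"
    and "edge_cover (\<A> \<union> \<B>) G"
  shows "reg_quotient_ring (binomial_edge_ideal G :: ('v + 'v, 'k::field) mpoly set)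
           \<le> ereal (real (card \<A>) + 2 * real (card \<B>))"
proof -
  define A where "A = verts ` \<A>"
  have "\<forall>H\<in>\<B>. \<exists>v. \<forall>e\<in>edges H. v \<in> e"
  proof
    fix H assume "H \<in> \<B>"
    then have "simple_graph H" "\<exists>m. graph_isomorphic H (star_graph m)"
      using assms(4) unfolding subgraph_of_def by blast+
    then show "\<exists>v. \<forall>e\<in>edges H. v \<in> e" using star_subgraph_centre by blast
  qed
  from bchoice[OF this] obtain centre where centre: "\<forall>H\<in>\<B>. \<forall>e\<in>edges H. centre H \<in> e" ..
  define S where "S = centre ` \<B>"
  \<comment> \<open>Reflexive on the vertices of the cliques, so that \<open>E\<close> contains
    their squares; the loops contribute only f_ii = 0.\<close>
  define E where "E = {(i, j). {i, j} \<in> edges G} \<union> Id_on (\<Union>A)"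
  have "sym E" by (auto simp: E_def sym_def insert_commute)
  moreover have "C \<times> C \<subseteq> E" if "C \<in> A" for C
  proof -
    obtain H where H: "H \<in> \<A>" "C = verts H" using \<open>C \<in> A\<close> unfolding A_def by blast
    then have G: "simple_graph H" "edges H \<subseteq> edges G" "\<exists>m. graph_isomorphic H (complete_graph m)"
      using assms(3) unfolding subgraph_of_def by blast+
    have "{i, j} \<in> edges G" if "i \<in> C" "j \<in> C" "i \<noteq> j" for i j
      using G complete_subgraph_edge[of H _ i j] that H(2) by blast
    then show ?thesis using \<open>C \<in> A\<close> by (auto simp: E_def)
  qed
  moreover have "(\<exists>C\<in>A. i \<in> C \<and> j \<in> C) \<or> i \<in> S \<or> j \<in> S" if "(i, j) \<in> E" for i j
  proof (cases "{i, j} \<in> edges G")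
    case True
    then have "{i, j} \<in> (\<Union>H\<in>\<A> \<union> \<B>. edges H)"
      using assms(5) unfolding edge_cover_def by simp
    then obtain H where H: "H \<in> \<A> \<union> \<B>" "{i, j} \<in> edges H" by blast
    show ?thesis
    proof (cases "H \<in> \<B>")
      case True
      have "centre H \<in> {i, j}" by (rule bspec[OF bspec[OF centre True] H(2)])
      moreover have "centre H \<in> S" using True by (simp add: S_def)
      ultimately show ?thesis by auto
    next
      case False
      then have "H \<in> \<A>" using H by blast
      then have "{i, j} \<subseteq> verts H"
        using H(2) assms(3) by (meson simple_graph_def subgraph_of_def)
      then have "\<exists>C\<in>A. i \<in> C \<and> j \<in> C" using \<open>H \<in> \<A>\<close> unfolding A_def by blast
      then show ?thesis ..
    qed
  qed (use that in \<open>auto simp: E_def\<close>)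
  ultimately have reg: "koszul_regular (int (card A + 2 * card S)) (mixed_ideal (vertex_vars {}) E :: ('v + 'v, 'k) mpoly set)"
    by (rule koszul_regular_cover)
  have eq: "mixed_ideal (vertex_vars {}) E = (binomial_edge_ideal G :: ('v + 'v, 'k) mpoly set)"
  proof
    show "mixed_ideal (vertex_vars {}) E \<subseteq> (binomial_edge_ideal G :: ('v + 'v, 'k) mpoly set)"
      unfolding binomial_edge_ideal_def edge_binomial_def[symmetric]
    proof (rule mixed_ideal_subsetI)
      fix i j assume "(i, j) \<in> E"
      then show "edge_binomial i j \<in> (ideal_gen {edge_binomial i j | i j. {i, j} \<in> edges G} :: ('v + 'v, 'k) mpoly set)"
        by (cases "i = j") (auto simp: E_def edge_binomial_refl intro!: ideal_gen_base)
    qed (simp add: vertex_vars_def)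
    show "(binomial_edge_ideal G :: ('v + 'v, 'k) mpoly set) \<subseteq> mixed_ideal (vertex_vars {}) E"
      unfolding binomial_edge_ideal_def edge_binomial_def[symmetric]
      by (rule ideal_gen_mono) (auto simp: mixed_gens_def E_def)
  qed
  have "mixed_ideal {} {} = ({0} :: ('v + 'v, 'k) mpoly set)"
    unfolding ideal_gen_def mixed_gens_def by (simp add: Modules.module.span_empty[OF module_mult])
  then have reg0: "koszul_regular 0 ({0} :: ('v + 'v, 'k) mpoly set)"
    using koszul_regular_variables[of "{} :: ('v + 'v) set", where ?'k = 'k] by simp
  \<comment> \<open>Different stars may share a centre, so \<open>S\<close> can be smaller than
    \<open>\<B>\<close>.\<close>
  have card: "card A \<le> card \<A>" "card S \<le> card \<B>"
    by (auto simp: A_def S_def intro!: card_image_le)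
  show ?thesis
    unfolding reg_quotient_ring_def cm_regularity_def
  proof (rule Sup_least, elim CollectE exE conjE)
    fix x b d \<phi> g i k
    assume x: "x = ereal (real_of_int (d i k) - real i)"
      and res: "minimal_graded_free_resolution (*) homogeneous (binomial_edge_ideal G :: ('v + 'v, 'k) mpoly set) b d \<phi> g"
      and k: "k < b i"
    have res': "minimal_graded_free_resolution (*) homogeneous
        (mixed_ideal (vertex_vars {}) E :: ('v + 'v, 'k) mpoly set) b d \<phi> g"
      unfolding eq by (rule res)
    have "d i k \<le> int i + int (card A + 2 * card S)"
      by (rule degree_le_of_koszul_regular[of "int (card A + 2 * card S)" "mixed_gens (vertex_vars {}) E"
            b d \<phi> g k i, OF reg0 reg res' k])
    then have "d i k - int i \<le> int (card \<A>) + 2 * int (card \<B>)" using card by linarith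
    then have "real_of_int (d i k - int i) \<le> real_of_int (int (card \<A>) + 2 * int (card \<B>))"
      by (simp only: of_int_le_iff)
    then show "x \<le> ereal (real (card \<A>) + 2 * real (card \<B>))"
      unfolding x by simp
  qed
qed

end
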